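(* $\mathrm{SSCM}(0,*;3;*,* )=\mathrm{RE}$. That is, a language is recursively enumerable if and only if it is generated by an SCM grammar with all of the following properties: - at most $3$ nonterminals; - every matrix has $P=\emptyset$, so there are no permitting conditions, while forbidden strings may be of arbitrary length; - an arbitrary finite number of conditional matrices; - matrices of arbitrary finite length.
   Context: A semi-conditional matrix (SCM) grammar is a quadruple $G=(V,T,M,S)$ with the following components. - $V$ is a finite alphabet and $T\subsetneq V$ is the set of terminals. - $N=V\setminus T$ is the set of nonterminals and $S\in N$ is the start symbol. - $M$ is a finite set of matrices of the form $r=[(A_1\to x_1),\dots,(A_\ell\to x_\ell),P,F]$, where $\ell\ge 1$, $A_k\in N$, $x_k\in V^*$, and $P,F\in V^+\cup\{\emptyset\}$. Here $\emptyset\notin V$ is a special symbol meaning that the condition is absent, and $|\emptyset|=0$. The number $\ell$ is the length of $r$. A matrix is classified as follows: - unconditional if $P=F=\emptyset$, and conditional otherwise; - simple if at least one of $P,F$ equals $\emptyset$, and non-simple if both $P\neq\emptyset$ and $F\neq\emptyset$. For $x,y\in V^*$ we write $x\Rightarrow_r y$ iff all of the following hold: 1. if $P\neq\emptyset$ then $P$ is a subword (factor) of $x$; 2. if $F\neq\emptyset$ then $F$ is not a subword of $x$; 3. there are words $x=y_0,y_1,\dots,y_\ell=y$ such that $y_k$ is obtained from $y_{k-1}$ by replacing one occurrence of $A_k$ by $x_k$. $\Rightarrow_G$ is the union of the relations $\Rightarrow_r$ over $r\in M$, and $L(G)=\{y\in T^*: S\Rightarrow_G^* y\}$. $G$ has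 degree $(i,j)$ if every matrix satisfies $|P|\le i$ and $|F|\le j$. $\mathrm{SCM}(i,j;n;m,\ell,s)$ denotes the family of languages $L(G)$ of SCM grammars $G$ that satisfy all of the following: - $G$ has degree $(i,j)$; - $|N|\le n$; - $G$ has at most $m$ conditional matrices; - every matrix of $G$ has length at most $\ell$; - $G$ has at most $s$ non-simple matrices. A $*$ in a parameter position means that parameter is unbounded. $\mathrm{SSCM}(i,j;n;m,\ell)=\mathrm{SCM}(i,j;n;m,\ell,0)$, i.e., all matrices are simple. $\mathrm{RE}$ is the class of recursively enumerable languages. *)

theory Defs
  imports Main "HOL-Library.Sublist"
begin

text \<open>Symbols: terminals are values of an arbitrary type 'a, nonterminals are natural numbers.
  The alphabet V of a grammar is Tm ` T \<union> Nt ` N, so T and N are automatically disjoint.\<close>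

datatype 'a sym = Tm 'a | Nt nat

definition alph :: "'a set \<Rightarrow> nat set \<Rightarrow> 'a sym set" where
  "alph T N = Tm ` T \<union> Nt ` N"

text \<open>A matrix: list of rules (A_k \<rightarrow> x_k), permitting string P and forbidden string F.
  The absent condition (the special symbol \<emptyset>) is represented by None.\<close>

record 'a matrix =
  rules :: "(nat \<times> 'a sym list) list"
  permit :: "'a sym list option"
  forbid :: "'a sym list option"

record 'a scm_grammar =
  sterms :: "'a set"
  snonterms :: "nat set"
  smats :: "'a matrix set"
  sstart :: nat

definition cond_ok :: "'a sym set \<Rightarrow> 'a sym list option \<Rightarrow> bool" where
  "cond_ok V c = (case c of None \<Rightarrow> True | Some w \<Rightarrow> w \<noteq> [] \<and> set w \<subseteq> V)"

definition scm_wf :: "'a scm_grammar \<Rightarrow> bool" where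
  "scm_wf G \<longleftrightarrow> finite (sterms G) \<and> finite (snonterms G) \<and> sstart G \<in> snonterms G
     \<and> finite (smats G)
     \<and> (\<forall>r \<in> smats G. rules r \<noteq> []
          \<and> (\<forall>(A, x) \<in> set (rules r). A \<in> snonterms G \<and> set x \<subseteq> alph (sterms G) (snonterms G))
          \<and> cond_ok (alph (sterms G) (snonterms G)) (permit r)
          \<and> cond_ok (alph (sterms G) (snonterms G)) (forbid r))"

fun apply_rules :: "(nat \<times> 'a sym list) list \<Rightarrow> 'a sym list \<Rightarrow> 'a sym list \<Rightarrow> bool" where
  "apply_rules [] x y \<longleftrightarrow> x = y"
| "apply_rules ((A, w) # rs) x y \<longleftrightarrow>
     (\<exists>u v. x = u @ [Nt A] @ v \<and> apply_rules rs (u @ w @ v) y)"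

definition mat_step :: "'a matrix \<Rightarrow> 'a sym list \<Rightarrow> 'a sym list \<Rightarrow> bool" where
  "mat_step r x y \<longleftrightarrow>
     (case permit r of None \<Rightarrow> True | Some p \<Rightarrow> sublist p x)
   \<and> (case forbid r of None \<Rightarrow> True | Some f \<Rightarrow> \<not> sublist f x)
   \<and> apply_rules (rules r) x y"

definition scm_step :: "'a scm_grammar \<Rightarrow> 'a sym list \<Rightarrow> 'a sym list \<Rightarrow> bool" where
  "scm_step G x y \<longleftrightarrow> (\<exists>r \<in> smats G. mat_step r x y)"

definition scm_lang :: "'a scm_grammar \<Rightarrow> 'a list set" where
  "scm_lang G = {w. set w \<subseteq> sterms G \<and> (scm_step G)\<^sup>*\<^sup>* [Nt (sstart G)] (map Tm w)}"

text \<open>SSCM(0,*;3;*,*): degree (0,*) (no permitting strings), at most 3 nonterminals,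
  unboundedly many conditional matrices of unbounded length; all matrices are then simple.\<close>

definition SSCM_0_star_3 :: "'a list set set" where
  "SSCM_0_star_3 = {L. \<exists>G. scm_wf G \<and> card (snonterms G) \<le> 3
                         \<and> (\<forall>r \<in> smats G. permit r = None) \<and> L = scm_lang G}"

record 'a ps_grammar =
  pterms :: "'a set"
  pnonterms :: "nat set"
  prods :: "('a sym list \<times> 'a sym list) set"
  pstart :: nat

definition ps_wf :: "'a ps_grammar \<Rightarrow> bool" where
  "ps_wf G \<longleftrightarrow> finite (pterms G) \<and> finite (pnonterms G) \<and> pstart G \<in> pnonterms G
     \<and> finite (prods G)
     \<and> (\<forall>(\<alpha>, \<beta>) \<in> prods G. set \<alpha> \<subseteq> alph (pterms G) (pnonterms G)
          \<and> set \<beta> \<subseteq> alph (pterms G) (pnonterms G)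
          \<and> (\<exists>A. Nt A \<in> set \<alpha>))"

definition ps_step :: "'a ps_grammar \<Rightarrow> 'a sym list \<Rightarrow> 'a sym list \<Rightarrow> bool" where
  "ps_step G x y \<longleftrightarrow> (\<exists>(\<alpha>, \<beta>) \<in> prods G. \<exists>u v. x = u @ \<alpha> @ v \<and> y = u @ \<beta> @ v)"

definition ps_lang :: "'a ps_grammar \<Rightarrow> 'a list set" where
  "ps_lang G = {w. set w \<subseteq> pterms G \<and> (ps_step G)\<^sup>*\<^sup>* [Nt (pstart G)] (map Tm w)}"

definition RE :: "'a list set set" where
  "RE = {L. \<exists>G. ps_wf G \<and> L = ps_lang G}"

end

theory Submission
  imports Defs
begin

text \<open>
  A phrase-structure grammar whose left-hand sides consist of nonterminals only is simulated with the
  nonterminals \<open>A\<close>, \<open>B\<close>, \<open>C\<close> as follows. A sentential form is stored by replacing the \<open>k\<close>-th nonterminal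
  by \<open>A\<^sup>k\<^sup>+\<^sup>1B\<close> and appending the code of a sentinel. One production is carried out by a straight-line
  program: a block of \<open>C\<close>s is inserted in front of a code word, and the code words of the left-hand side
  are deleted to the right of the block. Deletions may hit letters anywhere, but if the letters next to
  the block survive, then \<open>CA\<close> or \<open>CB\<close> occurs, and a later matrix forbids this.
  The length of the \<open>C\<close>-block is the program counter. A matrix can only demand at least \<open>c\<close> many \<open>C\<close>s, but
  the counter values are \<open>Z - 3\<^sup>k\<close> with \<open>k\<close> decreasing along the program, so that a matrix used too late
  overshoots \<open>Z\<close> forever, and the closing matrix tests the exact value \<open>c\<close> by forbidding \<open>C\<^sup>c\<^sup>+\<^sup>1\<close>.

  Conversely, a phrase-structure grammar checks a forbidden word and applies the rules of a matrix by
  means of a head symbol that walks over the sentential form between two end markers.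
\<close>

section \<open>Programs on words with a marked position\<close>

text \<open>The middle word does not contain \<open>x\<close>, so the marked \<open>x\<close> falls
  into one of the outer words. With the block of \<open>C\<close>s as the middle word, this locates
  a rewritten letter.\<close>

lemma occurrence_append3:
  assumes "p @ x # q = u @ m @ v" "x \<notin> set m"
  shows "(\<exists>r. u = p @ x # r \<and> q = r @ m @ v) \<or> (\<exists>r. v = r @ x # q \<and> p = u @ m @ r)"
proof -
  from assms(1) consider t where "p = u @ t" "t @ x # q = m @ v"
    | t where "u = p @ t" "x # q = t @ m @ v"
    by (auto simp: append_eq_append_conv2)
  then show ?thesis
  proof cases
    case 1
    then consider s where "t = m @ s" "s @ x # q = v" | s where "m = t @ s" "x # q = s @ v"
      by (auto simp: append_eq_append_conv2)
    then show ?thesis using 1 assms(2) by cases (auto simp: Cons_eq_append_conv)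
  next
    case 2
    then show ?thesis
    proof (cases t)
      case Nil
      then have "m = []" using 2 assms(2) by (cases m) auto
      then show ?thesis using 2 Nil by auto
    qed auto
  qed
qed

lemma apply_rules_append:
  "apply_rules (rs @ rs') x y \<longleftrightarrow> (\<exists>z. apply_rules rs x z \<and> apply_rules rs' z y)"
  by (induction rs x y rule: apply_rules.induct) auto

abbreviation LA :: "'a sym" where "LA \<equiv> Nt 0"
abbreviation LB :: "'a sym" where "LB \<equiv> Nt 1"
abbreviation LC :: "'a sym" where "LC \<equiv> Nt 2"

text \<open>A configuration \<open>(u, v)\<close> stands for every word \<open>u C\<^sup>n v\<close> with \<open>n > 0\<close> and no \<open>C\<close> in \<open>u\<close> and \<open>v\<close>.\<close>

datatype 'a test = NotRight "'a sym list" | NotLeft "'a sym list" | Absent nat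

text \<open>A single \<open>C\<close> anchors the forbidden word at the block: in a well-formed test
  \<open>p\<close> is nonempty and free of \<open>C\<close>, so the anchor can only be the last or
  the first \<open>C\<close> of the block.\<close>

fun test_word :: "'a test \<Rightarrow> 'a sym list" where
  "test_word (NotRight p) = LC # p"
| "test_word (NotLeft p) = p @ [LC]"
| "test_word (Absent n) = [Nt n]"

fun test_ok :: "'a test \<Rightarrow> 'a sym list \<times> 'a sym list \<Rightarrow> bool" where
  "test_ok (NotRight p) (u, v) \<longleftrightarrow> \<not> prefix p v"
| "test_ok (NotLeft p) (u, v) \<longleftrightarrow> \<not> suffix p u"
| "test_ok (Absent n) (u, v) \<longleftrightarrow> Nt n \<notin> set u \<union> set v"

datatype 'a instr = Test "'a test" | Repl nat nat "'a sym list"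

text \<open>A matrix cannot choose the side of the block on which a letter is rewritten, so each
  rule may act on either side; unwanted choices are excluded later by tests.\<close>

fun pair_rules ::
  "(nat \<times> 'a sym list) list \<Rightarrow> 'a sym list \<times> 'a sym list \<Rightarrow> 'a sym list \<times> 'a sym list \<Rightarrow> bool" where
  "pair_rules [] s t \<longleftrightarrow> s = t"
| "pair_rules ((a, w) # rs) (u, v) t \<longleftrightarrow>
     (\<exists>p q. u = p @ Nt a # q \<and> pair_rules rs (p @ w @ q, v) t) \<or>
     (\<exists>p q. v = p @ Nt a # q \<and> pair_rules rs (u, p @ w @ q) t)"

fun instr_step :: "'a instr \<Rightarrow> 'a sym list \<times> 'a sym list \<Rightarrow> 'a sym list \<times> 'a sym list \<Rightarrow> bool" where
  "instr_step (Test c) s t \<longleftrightarrow> s = t \<and> test_ok c s"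
| "instr_step (Repl k a w) s t \<longleftrightarrow> pair_rules (replicate k (a, w)) s t"

fun run :: "'a instr list \<Rightarrow> 'a sym list \<times> 'a sym list \<Rightarrow> 'a sym list \<times> 'a sym list \<Rightarrow> bool" where
  "run [] s t \<longleftrightarrow> s = t"
| "run (i # is) s t \<longleftrightarrow> (\<exists>s'. instr_step i s s' \<and> run is s' t)"

lemma run_append: "run (is @ js) s t \<longleftrightarrow> (\<exists>s'. run is s s' \<and> run js s' t)"
  by (induction "is" arbitrary: s) auto

fun instr_wf :: "'a sym set \<Rightarrow> 'a instr \<Rightarrow> bool" where
  "instr_wf V (Test (NotRight p)) \<longleftrightarrow> p \<noteq> [] \<and> set p \<subseteq> V"
| "instr_wf V (Test (NotLeft p)) \<longleftrightarrow> p \<noteq> [] \<and> set p \<subseteq> V"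
| "instr_wf V (Test (Absent n)) \<longleftrightarrow> Nt n \<in> V"
| "instr_wf V (Repl k a w) \<longleftrightarrow> Nt a \<in> V \<and> set w \<subseteq> V"

text \<open>Rules for letters other than \<open>C\<close> leave the block intact, so each of them
  acts on one side only.\<close>

lemma apply_rules_block:
  assumes "\<And>a w. (a, w) \<in> set rs \<Longrightarrow> a \<noteq> 2"
  shows "apply_rules rs (u @ replicate n LC @ v) y \<longleftrightarrow>
    (\<exists>u' v'. y = u' @ replicate n LC @ v' \<and> pair_rules rs (u, v) (u', v'))"
  using assms
proof (induction rs arbitrary: u v)
  case Nil
  then show ?case by auto
next
  case (Cons r rs)
  obtain a w where r: "r = (a, w)" by force
  with Cons.prems have a: "a \<noteq> 2" by auto
  have IH: "apply_rules rs (u @ replicate n LC @ v) y \<longleftrightarrow>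
    (\<exists>u' v'. y = u' @ replicate n LC @ v' \<and> pair_rules rs (u, v) (u', v'))" for u v
    using Cons.prems by (intro Cons.IH) auto
  show ?case
  proof
    assume "apply_rules (r # rs) (u @ replicate n LC @ v) y"
    then obtain p q where pq: "p @ Nt a # q = u @ replicate n LC @ v"
      and *: "apply_rules rs (p @ w @ q) y" by (auto simp: r)
    from occurrence_append3[OF pq] a
    consider s where "u = p @ Nt a # s" "q = s @ replicate n LC @ v"
      | s where "v = s @ Nt a # q" "p = u @ replicate n LC @ s" by fastforce
    then show "\<exists>u' v'. y = u' @ replicate n LC @ v' \<and> pair_rules (r # rs) (u, v) (u', v')"
    proof cases
      case 1
      then obtain u' v' where "y = u' @ replicate n LC @ v'" "pair_rules rs (p @ w @ s, v) (u', v')"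
        using * IH[of "p @ w @ s" v] by auto
      with 1 show ?thesis unfolding r pair_rules.simps by blast
    next
      case 2
      then obtain u' v' where "y = u' @ replicate n LC @ v'" "pair_rules rs (u, s @ w @ q) (u', v')"
        using * IH[of u "s @ w @ q"] by auto
      with 2 show ?thesis unfolding r pair_rules.simps by blast
    qed
  next
    assume "\<exists>u' v'. y = u' @ replicate n LC @ v' \<and> pair_rules (r # rs) (u, v) (u', v')"
    then obtain u' v' where y: "y = u' @ replicate n LC @ v'"
      and "pair_rules (r # rs) (u, v) (u', v')" by blast
    then consider p q where "u = p @ Nt a # q" "pair_rules rs (p @ w @ q, v) (u', v')"
      | p q where "v = p @ Nt a # q" "pair_rules rs (u, p @ w @ q) (u', v')" by (auto simp: r)
    then show "apply_rules (r # rs) (u @ replicate n LC @ v) y"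
    proof cases
      case 1
      then have "apply_rules rs ((p @ w @ q) @ replicate n LC @ v) y" using IH y by blast
      with 1 show ?thesis unfolding r by (simp, metis append.assoc)
    next
      case 2
      then have "apply_rules rs (u @ replicate n LC @ (p @ w @ q)) y" using IH y by blast
      with 2 show ?thesis unfolding r by (simp, metis append.assoc)
    qed
  qed
qed

lemma pair_rules_set:
  assumes "pair_rules rs (u, v) (u', v')" "\<And>a w. (a, w) \<in> set rs \<Longrightarrow> set w \<subseteq> V"
    "set u \<subseteq> V" "set v \<subseteq> V"
  shows "set u' \<subseteq> V \<and> set v' \<subseteq> V"
  using assms
proof (induction rs arbitrary: u v)
  case Nil
  then show ?case by auto
next
  case (Cons r rs)
  obtain a w where r: "r = (a, w)" by force
  from Cons.prems(1) consider p q where "u = p @ Nt a # q" "pair_rules rs (p @ w @ q, v) (u', v')"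
      | p q where "v = p @ Nt a # q" "pair_rules rs (u, p @ w @ q) (u', v')" by (auto simp: r)
  then show ?case
  proof cases
    case 1
    show ?thesis by (rule Cons.IH[OF 1(2)]) (use Cons.prems 1 r in auto)
  next
    case 2
    show ?thesis by (rule Cons.IH[OF 2(2)]) (use Cons.prems 2 r in auto)
  qed
qed

lemma instr_step_set:
  assumes "instr_step i (u, v) (u', v')" "instr_wf V i" "set u \<subseteq> V" "set v \<subseteq> V"
  shows "set u' \<subseteq> V \<and> set v' \<subseteq> V"
proof (cases i)
  case (Repl k a w)
  then show ?thesis using assms by (intro pair_rules_set[of "replicate k (a, w)" u v]) auto
qed (use assms in auto)

lemma prefix_split_unique:
  assumes "p @ x # q = u @ x # v" "x \<notin> set p" "x \<notin> set u"
  shows "p = u \<and> q = v"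
  using assms by (auto simp: append_eq_append_conv2 append_eq_Cons_conv Cons_eq_append_conv)

text \<open>All \<open>C\<close>s of the word belong to the block; the induction splits off the
  first of them by uniqueness of the first occurrence.\<close>

lemma block_occurrence:
  assumes "LC \<notin> set u" "LC \<notin> set v"
  shows "p @ LC # q = u @ replicate n LC @ v \<longleftrightarrow>
    (\<exists>i j. n = i + Suc j \<and> p = u @ replicate i LC \<and> q = replicate j LC @ v)"
  using assms(1)
proof (induction n arbitrary: u p)
  case 0
  then have "LC \<notin> set (u @ v)" using assms(2) by auto
  then have "p @ LC # q \<noteq> u @ v" by (metis in_set_conv_decomp)
  then show ?case by simp
next
  case (Suc n)
  show ?case
  proof
    assume eq: "p @ LC # q = u @ replicate (Suc n) LC @ v"
    show "\<exists>i j. Suc n = i + Suc j \<and> p = u @ replicate i LC \<and> q = replicate j LC @ v"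
    proof (cases "LC \<in> set p")
      case False
      then have "p = u \<and> q = replicate n LC @ v"
        using prefix_split_unique[of p LC q u "replicate n LC @ v"] eq Suc.prems by auto
      then show ?thesis by (intro exI[of _ 0] exI[of _ n]) auto
    next
      case True
      then obtain s1 s2 where s: "p = s1 @ LC # s2" "LC \<notin> set s1" by (meson split_list_first)
      then have *: "s1 = u" "s2 @ LC # q = [] @ replicate n LC @ v"
        using prefix_split_unique[of s1 LC "s2 @ LC # q" u "replicate n LC @ v"] eq Suc.prems by auto
      then obtain i j where "n = i + Suc j" "s2 = replicate i LC" "q = replicate j LC @ v"
        using Suc.IH[of "[]" s2] by auto
      then show ?thesis using s(1) *(1) by (intro exI[of _ "Suc i"] exI[of _ j]) auto
    qed
  next
    assume "\<exists>i j. Suc n = i + Suc j \<and> p = u @ replicate i LC \<and> q = replicate j LC @ v"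
    then show "p @ LC # q = u @ replicate (Suc n) LC @ v"
      by (metis append.assoc append_Cons replicate_Suc replicate_add)
  qed
qed

lemma sublist_test_word:
  assumes "instr_wf V (Test c)" "LC \<notin> V" "LC \<notin> set u" "LC \<notin> set v" "n > 0"
  shows "sublist (test_word c) (u @ replicate n LC @ v) \<longleftrightarrow> \<not> test_ok c (u, v)"
proof (cases c)
  case (NotRight p)
  have p: "p \<noteq> []" "LC \<notin> set p" using assms NotRight by auto
  obtain m where n: "n = Suc m" using assms(5) gr0_conv_Suc by auto
  have "prefix p v" if eq: "s @ LC # p @ t = u @ replicate n LC @ v" for s t
  proof -
    obtain j where j: "p @ t = replicate j LC @ v"
      using eq unfolding block_occurrence[OF assms(3,4)] by blast
    \<comment> \<open>\<open>j\<close> is the number of block letters behind the anchor;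
      \<open>p\<close> does not begin with \<open>C\<close>, so the anchor is the last
      \<open>C\<close>.\<close>
    with p have "j = 0" by (cases j; cases p) auto
    with j show ?thesis by (auto simp: prefix_def)
  qed
  moreover have "sublist (LC # p) (u @ replicate n LC @ v)" if "prefix p v"
  proof -
    obtain t where "v = p @ t" using \<open>prefix p v\<close> by (auto simp: prefix_def)
    then have "u @ replicate n LC @ v = (u @ replicate m LC) @ (LC # p) @ t"
      using n by (simp add: replicate_append_same)
    then show ?thesis by (metis sublist_appendI)
  qed
  ultimately show ?thesis using NotRight by (auto simp: sublist_def)
next
  case (NotLeft p)
  have p: "p \<noteq> []" "LC \<notin> set p" using assms NotLeft by auto
  obtain m where n: "n = Suc m" using assms(5) gr0_conv_Suc by auto
  have "suffix p u" if eq: "s @ (p @ [LC]) @ t = u @ replicate n LC @ v" for s t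
  proof -
    obtain p' x where px: "p = p' @ [x]" using p by (metis rev_exhaust)
    then have x: "x \<noteq> LC" using p by auto
    \<comment> \<open>The last letter \<open>x\<close> of \<open>p\<close> is not \<open>C\<close>
      but is followed by one, hence it is the last letter of \<open>u\<close>.\<close>
    have "(s @ p') @ x # LC # t = u @ replicate n LC @ v" using eq px by simp
    from occurrence_append3[OF this] x consider
      r where "u = (s @ p') @ x # r" "LC # t = r @ replicate n LC @ v"
      | r where "v = r @ x # LC # t" by fastforce
    then show ?thesis
    proof cases
      case 1
      with assms(3) have "r = []" by (cases r) auto
      then show ?thesis using 1 px by (auto simp: suffix_def)
    qed (use assms(4) in auto)
  qed
  moreover have "sublist (p @ [LC]) (u @ replicate n LC @ v)" if "suffix p u"
  proof -
    obtain t where "u = t @ p" using \<open>suffix p u\<close> by (auto simp: suffix_def)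
    then have "u @ replicate n LC @ v = t @ (p @ [LC]) @ replicate m LC @ v"
      using n by simp
    then show ?thesis by (metis sublist_appendI)
  qed
  ultimately show ?thesis using NotLeft by (auto simp: sublist_def)
next
  case (Absent k)
  have "sublist [x] xs \<longleftrightarrow> x \<in> set xs" for x :: "'a sym" and xs
    by (auto simp: sublist_def in_set_conv_decomp)
  then show ?thesis using Absent assms by auto
qed

text \<open>Which \<open>C\<close> is replaced does not matter, since the new \<open>C\<close>s
  merge with the old ones into one block.\<close>

lemma apply_rules_grow_block:
  assumes "LC \<notin> set u" "LC \<notin> set v"
  shows "apply_rules ((2, replicate m LC) # rs) (u @ replicate n LC @ v) y \<longleftrightarrow>
    n > 0 \<and> apply_rules rs (u @ replicate (n - 1 + m) LC @ v) y"
proof -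
  have *: "replicate i x @ replicate m x @ replicate j x = replicate (i + j + m) x" for i j and x :: "'a sym"
    by (metis replicate_add add.assoc add.commute)
  have "apply_rules ((2, replicate m LC) # rs) (u @ replicate n LC @ v) y \<longleftrightarrow>
    (\<exists>p q. p @ LC # q = u @ replicate n LC @ v \<and> apply_rules rs (p @ replicate m LC @ q) y)"
    by (simp, metis)
  also have "\<dots> \<longleftrightarrow> (\<exists>i j. n = i + Suc j \<and>
      apply_rules rs (u @ (replicate i LC @ replicate m LC @ replicate j LC) @ v) y)"
    unfolding block_occurrence[OF assms] by (metis append.assoc)
  also have "\<dots> \<longleftrightarrow> (\<exists>i j. n = i + Suc j \<and> apply_rules rs (u @ replicate (n - 1 + m) LC @ v) y)"
    unfolding * by (auto cong: conj_cong)
  also have "(\<exists>i j. n = i + Suc j \<and> apply_rules rs (u @ replicate (n - 1 + m) LC @ v) y) \<longleftrightarrow>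
      n > 0 \<and> apply_rules rs (u @ replicate (n - 1 + m) LC @ v) y"
    by (auto intro: exI[of _ 0] exI[of _ "n - 1"])
  finally show ?thesis .
qed

lemma apply_rules_delete_block:
  assumes "LC \<notin> set u" "LC \<notin> set v"
  shows "apply_rules (replicate c (2, [])) (u @ replicate n LC @ v) y \<longleftrightarrow>
    c \<le> n \<and> y = u @ replicate (n - c) LC @ v"
proof (induction c arbitrary: n)
  case (Suc c)
  show ?case
    using apply_rules_grow_block[OF assms, of 0 "replicate c (2, [])" n y] Suc.IH[of "n - 1"]
    by (auto simp del: apply_rules.simps)
qed auto

text \<open>Deleting \<open>c - 1\<close> symbols first is what enforces \<open>n \<ge> c\<close>: rules \<open>C \<rightarrow> C\<close> could all be applied to the
  same occurrence.\<close>

definition counter_rules :: "nat \<Rightarrow> nat \<Rightarrow> (nat \<times> 'a sym list) list" where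
  "counter_rules c d = replicate (c - 1) (2, []) @ [(2, replicate (c + d) LC)]"

text \<open>The \<open>c - 1\<close> deletions and the final replacement consume \<open>c\<close>
  symbols of the block and put back \<open>c + d\<close>.\<close>

lemma apply_counter_rules:
  assumes "LC \<notin> set u" "LC \<notin> set v" "c > 0"
  shows "apply_rules (counter_rules c d) (u @ replicate n LC @ v) y \<longleftrightarrow>
    c \<le> n \<and> y = u @ replicate (n + d) LC @ v"
proof -
  have "n - (c - 1) - 1 + (c + d) = n + d" if "c \<le> n" using that assms(3) by simp
  then show ?thesis
    unfolding counter_rules_def apply_rules_append apply_rules_delete_block[OF assms(1,2)]
    using apply_rules_grow_block[OF assms(1,2), of "c + d" "[]" "n - (c - 1)" y] assms(3)
    by (auto simp del: apply_rules.simps(2))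
qed

fun instr_matrix :: "nat \<Rightarrow> nat \<Rightarrow> 'a instr \<Rightarrow> 'a matrix" where
  "instr_matrix c d (Test t) = \<lparr>rules = counter_rules c d, permit = None, forbid = Some (test_word t)\<rparr>"
| "instr_matrix c d (Repl k a w) =
     \<lparr>rules = counter_rules c d @ replicate k (a, w), permit = None, forbid = None\<rparr>"

text \<open>The forbidden word is checked before the rules are applied, and its presence does not
  depend on the length of the nonempty block; hence tests and counter do not interfere.\<close>

lemma mat_step_instr_matrix:
  assumes "instr_wf V i" "LC \<notin> V" "set u \<subseteq> V" "set v \<subseteq> V" "n > 0" "c > 0"
  shows "mat_step (instr_matrix c d i) (u @ replicate n LC @ v) y \<longleftrightarrow>
    c \<le> n \<and> (\<exists>u' v'. instr_step i (u, v) (u', v') \<and> y = u' @ replicate (n + d) LC @ v')"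
proof -
  have C: "LC \<notin> set u" "LC \<notin> set v" using assms by auto
  show ?thesis
  proof (cases i)
    case (Test t)
    then show ?thesis
      using sublist_test_word[of V t u v n] assms C apply_counter_rules[OF C assms(6)]
      by (auto simp: mat_step_def)
  next
    case (Repl k a w)
    then have "a \<noteq> 2" using assms by auto
    then show ?thesis
      using apply_rules_block[of "replicate k (a, w)" u "n + d" v y]
      unfolding Repl mat_step_def instr_matrix.simps
      by (auto simp: apply_rules_append apply_counter_rules[OF C assms(6)])
  qed
qed

text \<open>All \<open>C\<close>s lie in one block, so counting them bounds
  \<open>m\<close>.\<close>

lemma sublist_block:
  fixes u v :: "'a sym list"
  assumes "LC \<notin> set u" "LC \<notin> set v"
  shows "sublist (replicate m LC) (u @ replicate n LC @ v) \<longleftrightarrow> m \<le> n"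
proof
  assume "sublist (replicate m LC) (u @ replicate n LC @ v)"
  then obtain s t where eq: "u @ replicate n LC @ v = s @ replicate m LC @ t" by (auto simp: sublist_def)
  have "count_list (u @ replicate n LC @ v) LC = n" 
    using assms by (simp add: count_list_0_iff) (induction n; simp)
  moreover have "count_list (replicate m (LC :: 'a sym)) LC = m" by (induction m) auto
  ultimately show "m \<le> n" unfolding eq by (simp only: count_list_append)
next
  assume "m \<le> n"
  then have "u @ replicate n LC @ v = u @ replicate m LC @ (replicate (n - m) LC @ v)"
    by (metis append.assoc le_add_diff_inverse replicate_add)
  then show "sublist (replicate m LC) (u @ replicate n LC @ v)" by (metis sublist_appendI)
qed

definition exec :: "nat \<times> 'a instr list \<Rightarrow> 'a sym list \<Rightarrow> 'a sym list \<Rightarrow> bool" where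
  "exec P x y \<longleftrightarrow> (\<exists>p q u v. x = p @ Nt (fst P) # q \<and> run (snd P) (p, Nt (fst P) # q) (u, v) \<and> y = u @ v)"

section \<open>The block of marker symbols as program counter\<close>

locale programs =
  fixes T :: "'a set" and Ps :: "(nat \<times> 'a instr list) list"
  assumes finite_terms: "finite T"
    and program_wf: "(a, is) \<in> set Ps \<Longrightarrow> a \<in> {0, 1} \<and> (\<forall>i \<in> set is. instr_wf (alph T {0, 1}) i)"
begin

text \<open>The positions \<open>(i, j)\<close> of all programs are numbered by \<open>idx\<close>.
  \<open>L\<close> exceeds every program length, so \<open>j < L\<close> holds and \<open>i\<close>
  can be read off as a quotient by \<open>L\<close>. Within a program \<open>idx\<close> decreases
  by one per instruction, and \<open>inc\<close> is the difference of successive counter values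
  because \<open>3^(k+1) - 3^k = 2 * 3^k\<close>.\<close>

definition L :: nat where "L = Suc (\<Sum>p\<leftarrow>Ps. length (snd p))"
definition idx :: "nat \<Rightarrow> nat \<Rightarrow> nat" where "idx i j = i * L + (L - 1 - j)"
definition Z :: nat where "Z = 3 ^ (length Ps * L + 1)"
definition cnt :: "nat \<Rightarrow> nat \<Rightarrow> nat" where "cnt i j = Z - 3 ^ idx i j"
definition inc :: "nat \<Rightarrow> nat \<Rightarrow> nat" where "inc i j = 2 * 3 ^ idx i (Suc j)"

abbreviation letter :: "nat \<Rightarrow> nat" where "letter i \<equiv> fst (Ps ! i)"
abbreviation code :: "nat \<Rightarrow> 'a instr list" where "code i \<equiv> snd (Ps ! i)"
abbreviation content :: "'a sym set" where "content \<equiv> alph T {0, 1}"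

text \<open>The case \<open>j = length (code i)\<close> is the position behind the last instruction,
  where the program is closed.\<close>

definition valid :: "nat \<Rightarrow> nat \<Rightarrow> bool" where
  "valid i j \<longleftrightarrow> i < length Ps \<and> j \<le> length (code i)"

lemma LC_content: "LC \<notin> content"
  by (auto simp: alph_def)

lemma valid_less_L: "valid i j \<Longrightarrow> j < L"
proof -
  assume v: "valid i j"
  then have "length (code i) \<in> set (map (\<lambda>p. length (snd p)) Ps)" by (auto simp: valid_def)
  then have "length (code i) \<le> (\<Sum>p\<leftarrow>Ps. length (snd p))" by (intro member_le_sum_list) simp_all
  with v show ?thesis by (simp add: L_def valid_def)
qed

lemma idx_bound: "valid i j \<Longrightarrow> idx i j < length Ps * L"
proof -
  assume v: "valid i j"
  then have "j < L" by (rule valid_less_L)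
  then have "idx i j < Suc i * L" by (auto simp: idx_def)
  also have "\<dots> \<le> length Ps * L" using v by (intro mult_right_mono) (auto simp: valid_def)
  finally show ?thesis .
qed

text \<open>This bound makes the truncated subtraction in \<open>cnt\<close> exact and the counter
  values positive.\<close>

lemma pow_idx_bound: "valid i j \<Longrightarrow> 3 * 3 ^ idx i j \<le> Z"
  using power_increasing[of "Suc (idx i j)" "length Ps * L + 1" "3::nat"] idx_bound[of i j]
  by (simp add: Z_def)

lemma cnt_pos: "valid i j \<Longrightarrow> cnt i j > 0"
proof -
  assume "valid i j"
  then have "3 * 3 ^ idx i j \<le> Z" by (rule pow_idx_bound)
  moreover have "3 ^ idx i j > (0::nat)" by simp
  ultimately show ?thesis unfolding cnt_def by linarith
qed

lemma cnt_less: "valid i j \<Longrightarrow> cnt i j < Z"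
  using pow_idx_bound[of i j] by (simp add: cnt_def Z_def)

lemma idx_Suc: "valid i (Suc j) \<Longrightarrow> idx i j = Suc (idx i (Suc j))"
  using valid_less_L[of i "Suc j"] by (simp add: idx_def)

lemma cnt_Suc: "valid i (Suc j) \<Longrightarrow> cnt i (Suc j) = cnt i j + inc i j"
  using pow_idx_bound[of i j] idx_Suc[of i j] by (simp add: cnt_def inc_def valid_def)

lemma idx_inj: 
  assumes "valid i j" "valid i' j'" "idx i j = idx i' j'"
  shows "i = i' \<and> j = j'"
proof -
  have "j < L" "j' < L" using assms valid_less_L by auto
  then have "idx i j div L = i" "idx i' j' div L = i'"
    by (auto simp: idx_def div_mult_self3 simp del: diff_diff_left add_diff_assoc)
  then have "i = i'" using assms(3) by simp
  with \<open>j < L\<close> \<open>j' < L\<close> show ?thesis using assms(3) by (auto simp: idx_def)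
qed

text \<open>Let \<open>k\<close> and \<open>k'\<close> be the indices of the instruction used and of
  the current position. The counter condition gives \<open>k' <= k\<close>, and a wrong position
  means \<open>k' < k\<close>. Then \<open>3^k' <= 3^(k - 1)\<close>, which is less than the
  increment \<open>2 * 3^(k - 1)\<close>, so the counter leaps over its remaining distance
  \<open>3^k'\<close> to \<open>Z\<close>.\<close>

lemma cnt_overshoot:
  assumes "valid i (Suc j)" "valid i' j'" "cnt i j \<le> cnt i' j'" "(i, j) \<noteq> (i', j')"
  shows "Z \<le> cnt i' j' + inc i j"
proof -
  have v: "valid i j" using assms(1) by (simp add: valid_def)
  have p: "3 * 3 ^ idx i j \<le> Z" "3 * 3 ^ idx i' j' \<le> Z" using pow_idx_bound v assms(2) by auto
  then have "3 ^ idx i' j' \<le> (3 ^ idx i j :: nat)" using assms(3) unfolding cnt_def by linarith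
  then have "idx i' j' \<le> idx i j" by simp
  moreover have "idx i' j' \<noteq> idx i j" using idx_inj[OF assms(2) v] assms(4) by auto
  ultimately have "idx i' j' \<le> idx i (Suc j)" using idx_Suc[OF assms(1)] by simp
  then have "3 ^ idx i' j' \<le> (3 ^ idx i (Suc j) :: nat)" by simp
  then show ?thesis unfolding cnt_def inc_def using p by linarith
qed

text \<open>Forbidding \<open>C\<close> prevents a second block from being opened while one is
  present.\<close>

definition start_matrix :: "nat \<Rightarrow> 'a matrix" where
  "start_matrix i = \<lparr>rules = [(letter i, replicate (cnt i 0) LC @ [Nt (letter i)])],
     permit = None, forbid = Some [LC]\<rparr>"

text \<open>Deleting \<open>c\<close> symbols needs at least \<open>c\<close> of them and the
  forbidden word allows at most \<open>c\<close>, so the counter is tested exactly.\<close>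

definition reset_matrix :: "nat \<Rightarrow> 'a matrix" where
  "reset_matrix i = (let c = cnt i (length (code i)) in
     \<lparr>rules = replicate c (2, []), permit = None, forbid = Some (replicate (Suc c) LC)\<rparr>)"

definition step_matrix :: "nat \<Rightarrow> nat \<Rightarrow> 'a matrix" where
  "step_matrix i j = instr_matrix (cnt i j) (inc i j) (code i ! j)"

definition grammar :: "'a scm_grammar" where
  "grammar = \<lparr>sterms = T, snonterms = {0, 1, 2},
     smats = start_matrix ` {..<length Ps} \<union> reset_matrix ` {..<length Ps} \<union>
       (\<lambda>(i, j). step_matrix i j) ` (SIGMA i:{..<length Ps}. {..<length (code i)}),
     sstart = 1\<rparr>"

section \<open>Well-formedness of the constructed grammar\<close>

lemma code_wf: "i < length Ps \<Longrightarrow> j < length (code i) \<Longrightarrow> instr_wf content (code i ! j)"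
  using program_wf[of "letter i" "code i"] by auto

lemma letter_wf: "i < length Ps \<Longrightarrow> letter i \<in> {0, 1}"
  using program_wf[of "letter i" "code i"] by auto

lemma instr_matrix_wf:
  assumes "instr_wf content x" "c > 0" "r = instr_matrix c d x" "V = alph T {0, 1, 2}"
  shows "rules r \<noteq> [] \<and> (\<forall>(A, x) \<in> set (rules r). A \<in> {0, 1, 2} \<and> set x \<subseteq> V)
     \<and> cond_ok V (permit r) \<and> cond_ok V (forbid r) \<and> permit r = None"
proof -
  have sub: "content \<subseteq> V" "LC \<in> V" using assms(4) by (auto simp: alph_def)
  have ctr: "(\<forall>(A, x) \<in> set (counter_rules c d). A \<in> {0, 1, 2} \<and> set x \<subseteq> V)"
    using sub by (auto simp: counter_rules_def)
  show ?thesis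
  proof (cases x)
    case (Test t)
    then show ?thesis using assms sub ctr 
      by (cases t) (auto simp: cond_ok_def counter_rules_def)
  next
    case (Repl k a w)
    then have "a \<in> {0, 1}" using assms(1) by (auto simp: alph_def)
    then show ?thesis using Repl assms sub ctr by (auto simp: cond_ok_def counter_rules_def)
  qed
qed

lemma grammar_wf: "scm_wf grammar" "\<forall>r \<in> smats grammar. permit r = None"
proof -
  let ?V = "alph T {0, 1, 2}"
  have sub: "content \<subseteq> ?V" "LC \<in> ?V" by (auto simp: alph_def)
  have *: "rules r \<noteq> [] \<and> (\<forall>(A, x) \<in> set (rules r). A \<in> {0, 1, 2} \<and> set x \<subseteq> ?V)
     \<and> cond_ok ?V (permit r) \<and> cond_ok ?V (forbid r) \<and> permit r = None" 
    if r: "r \<in> smats grammar" for r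
  proof -
    from r consider i where "i < length Ps" "r = start_matrix i" 
      | i where "i < length Ps" "r = reset_matrix i" 
      | i j where "i < length Ps" "j < length (code i)" "r = step_matrix i j"
      by (auto simp: grammar_def)
    then show ?thesis
    proof cases
      case 1
      then show ?thesis using sub letter_wf[of i] 
        by (auto simp: start_matrix_def cond_ok_def alph_def)
    next
      case 2
      then show ?thesis using sub cnt_pos[of i "length (code i)"] 
        by (auto simp: reset_matrix_def Let_def cond_ok_def valid_def)
    next
      case 3
      then show ?thesis using instr_matrix_wf[OF code_wf[OF 3(1,2)] cnt_pos[of i j], of r "inc i j", OF _ _ refl]
        by (simp add: step_matrix_def valid_def) (simp add: cond_ok_def)
    qed
  qed
  show "\<forall>r \<in> smats grammar. permit r = None" using * by blast
  have fields: "sterms grammar = T" "snonterms grammar = {0, 1, 2}" "sstart grammar = 1"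
    "finite (smats grammar)" by (simp_all add: grammar_def)
  show "scm_wf grammar" unfolding scm_wf_def fields(1-3) using * finite_terms fields(4) by blast
qed

definition macro :: "'a sym list \<Rightarrow> 'a sym list \<Rightarrow> bool" where
  "macro x y \<longleftrightarrow> (\<exists>P \<in> set Ps. exec P x y)"

lemma run_set:
  assumes "run is (u, v) (u', v')" "\<forall>i \<in> set is. instr_wf V i" "set u \<subseteq> V" "set v \<subseteq> V"
  shows "set u' \<subseteq> V \<and> set v' \<subseteq> V"
  using assms
proof (induction "is" arbitrary: u v)
  case (Cons i "is")
  then obtain u1 v1 where "instr_step i (u, v) (u1, v1)" "run is (u1, v1) (u', v')" by auto
  then show ?case using Cons instr_step_set[of i u v u1 v1 V] by auto
qed auto

lemma macro_set:
  assumes "macro x y" "set x \<subseteq> content"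
  shows "set y \<subseteq> content"
proof -
  from assms(1) obtain a "is" p q u v where P: "(a, is) \<in> set Ps" "x = p @ Nt a # q"
    "run is (p, Nt a # q) (u, v)" "y = u @ v" by (auto simp: macro_def exec_def)
  then have "set u \<subseteq> content \<and> set v \<subseteq> content"
    using run_set[OF P(3)] program_wf[OF P(1)] assms(2) by simp
  with P(4) show ?thesis by simp
qed

lemma macros_set: "macro\<^sup>*\<^sup>* x y \<Longrightarrow> set x \<subseteq> content \<Longrightarrow> set y \<subseteq> content"
  by (induction rule: rtranclp_induct) (blast dest: macro_set)+

lemma step_matrix_iff:
  assumes "valid i (Suc j)" "set u \<subseteq> content" "set v \<subseteq> content" "n > 0"
  shows "mat_step (step_matrix i j) (u @ replicate n LC @ v) y \<longleftrightarrow>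
    cnt i j \<le> n \<and> (\<exists>u' v'. instr_step (code i ! j) (u, v) (u', v') \<and> y = u' @ replicate (n + inc i j) LC @ v')"
  unfolding step_matrix_def using assms code_wf[of i j] cnt_pos[of i j] LC_content
  by (intro mat_step_instr_matrix[where V = content]) (auto simp: valid_def)

lemma reset_matrix_iff:
  assumes "i < length Ps" "set u \<subseteq> content" "set v \<subseteq> content"
  shows "mat_step (reset_matrix i) (u @ replicate n LC @ v) y \<longleftrightarrow>
    n = cnt i (length (code i)) \<and> y = u @ v"
proof -
  have C: "LC \<notin> set u" "LC \<notin> set v" using assms LC_content by auto
  show ?thesis
    unfolding mat_step_def reset_matrix_def Let_def
    using apply_rules_delete_block[OF C] sublist_block[OF C, of "Suc (cnt i (length (code i)))"]
    by (auto simp del: replicate.simps)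
qed

lemma start_matrix_iff:
  "mat_step (start_matrix i) x y \<longleftrightarrow> LC \<notin> set x \<and> (\<exists>p q. x = p @ Nt (letter i) # q 
    \<and> y = p @ replicate (cnt i 0) LC @ Nt (letter i) # q)"
  by (auto simp: mat_step_def start_matrix_def sublist_def in_set_conv_decomp)

text \<open>Words inside a program run that has followed the code so far, with the counter value of
  the position reached.\<close>

definition live :: "'a sym list \<Rightarrow> 'a sym list \<Rightarrow> bool" where
  "live x z \<longleftrightarrow> (\<exists>i j p q u v. valid i j \<and> macro\<^sup>*\<^sup>* x (p @ Nt (letter i) # q) \<and>
     run (take j (code i)) (p, Nt (letter i) # q) (u, v) \<and>
     set u \<subseteq> content \<and> set v \<subseteq> content \<and> z = u @ replicate (cnt i j) LC @ v)"

text \<open>Reset matrices need a counter value below \<open>Z\<close>, so a block of length at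
  least \<open>Z\<close> can never be removed.\<close>

definition dead :: "'a sym list \<Rightarrow> bool" where
  "dead z \<longleftrightarrow> (\<exists>u v n. set u \<subseteq> content \<and> set v \<subseteq> content \<and> Z \<le> n \<and> z = u @ replicate n LC @ v)"

lemma smats_cases:
  assumes "r \<in> smats grammar"
  obtains i where "i < length Ps" "r = start_matrix i" 
      | i where "i < length Ps" "r = reset_matrix i" 
      | i j where "valid i (Suc j)" "r = step_matrix i j"
  using assms by (auto simp: grammar_def valid_def Suc_le_eq)

text \<open>The block blocks every start matrix, its length blocks every reset, and instructions
  never shorten it.\<close>

lemma dead_step:
  assumes "dead z" "scm_step grammar z z'"
  shows "dead z'"
proof -
  from assms(1) obtain u v n where uv: "set u \<subseteq> content" "set v \<subseteq> content"
    and n: "Z \<le> n" and z: "z = u @ replicate n LC @ v" by (auto simp: dead_def)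
  have n0: "n > 0" using n by (auto simp: Z_def intro: ccontr)
  from assms(2) obtain r where r: "r \<in> smats grammar" "mat_step r z z'" by (auto simp: scm_step_def)
  from r(1) show ?thesis
  proof (cases rule: smats_cases)
    case (1 i)
    then show ?thesis using r z n0 by (auto simp: start_matrix_iff)
  next
    case (2 i)
    then show ?thesis using r z n reset_matrix_iff[OF 2(1) uv] cnt_less[of i "length (code i)"]
      by (auto simp: valid_def)
  next
    case (3 i j)
    then obtain u' v' where "instr_step (code i ! j) (u, v) (u', v')"
      "z' = u' @ replicate (n + inc i j) LC @ v'" 
      using step_matrix_iff[OF 3(1) uv n0] r z by auto
    moreover have "set u' \<subseteq> content \<and> set v' \<subseteq> content"
      using instr_step_set[OF calculation(1) code_wf uv] 3(1) by (auto simp: valid_def)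
    ultimately show ?thesis using n unfolding dead_def
      by (intro exI[of _ u'] exI[of _ v'] exI[of _ "n + inc i j"]) auto
  qed
qed

text \<open>Distinct positions have distinct counter values. Hence a reset occurs only at the end of
  the running program, and an instruction matrix either is the next one or overshoots to a dead
  word.\<close>

lemma live_step:
  assumes "live x z" "scm_step grammar z z'"
  shows "macro\<^sup>*\<^sup>* x z' \<or> live x z' \<or> dead z'"
proof -
  from assms(1) obtain i j p q u v where v: "valid i j" and m: "macro\<^sup>*\<^sup>* x (p @ Nt (letter i) # q)"
    and run: "run (take j (code i)) (p, Nt (letter i) # q) (u, v)"
    and uv: "set u \<subseteq> content" "set v \<subseteq> content" and z: "z = u @ replicate (cnt i j) LC @ v"
    by (auto simp: live_def)
  have n0: "cnt i j > 0" using v by (rule cnt_pos)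
  from assms(2) obtain r where r: "r \<in> smats grammar" "mat_step r z z'" by (auto simp: scm_step_def)
  from r(1) show ?thesis
  proof (cases rule: smats_cases)
    case (1 k)
    then show ?thesis using r z n0 by (auto simp: start_matrix_iff)
  next
    case (2 k)
    then have "cnt i j = cnt k (length (code k))" and z': "z' = u @ v"
      using reset_matrix_iff[OF 2(1) uv] r z by auto
    moreover have "valid k (length (code k))" using 2 by (auto simp: valid_def)
    \<comment> \<open>Both powers are at most \<open>Z\<close>, so equal counter values give equal
      powers.\<close>
    ultimately have "3 ^ idx i j = (3 ^ idx k (length (code k)) :: nat)"
      using pow_idx_bound[OF v] pow_idx_bound[of k "length (code k)"] unfolding cnt_def by linarith
    then have "idx i j = idx k (length (code k))" by simp
    then have "i = k \<and> j = length (code k)"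
      using idx_inj[OF v, of k "length (code k)"] 2 by (auto simp: valid_def)
    then have "macro (p @ Nt (letter i) # q) z'"
      unfolding macro_def exec_def using run z' 2(1)
      by (intro bexI[of _ "Ps ! i"] exI[of _ p] exI[of _ q] exI[of _ u] exI[of _ v]) auto
    then show ?thesis using m by (blast intro: rtranclp.rtrancl_into_rtrancl)
  next
    case (3 k l)
    then obtain u' v' where *: "instr_step (code k ! l) (u, v) (u', v')"
      "z' = u' @ replicate (cnt i j + inc k l) LC @ v'" "cnt k l \<le> cnt i j"
      using step_matrix_iff[OF 3(1) uv n0] r z by auto
    have s: "set u' \<subseteq> content" "set v' \<subseteq> content"
      using instr_step_set[OF *(1) code_wf uv] 3(1) by (auto simp: valid_def)
    show ?thesis
    proof (cases "(k, l) = (i, j)")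
      case True
      then have vs: "valid i (Suc j)" using 3 by auto
      then have "run (take (Suc j) (code i)) (p, Nt (letter i) # q) (u', v')"
        using run *(1) True by (auto simp: take_Suc_conv_app_nth valid_def run_append)
      then have "live x z'" unfolding live_def using vs m s *(2) True cnt_Suc[OF vs]
        by (intro exI[of _ i] exI[of _ "Suc j"] exI[of _ p] exI[of _ q] exI[of _ u'] exI[of _ v']) auto
      then show ?thesis by simp
    next
      case False
      then have "dead z'" unfolding dead_def using s *(2) cnt_overshoot[OF 3(1) v *(3) False]
        by (intro exI[of _ u'] exI[of _ v'] exI[of _ "cnt i j + inc k l"]) simp
      then show ?thesis by simp
    qed
  qed
qed

text \<open>Every matrix other than a start matrix consumes a \<open>C\<close>, so none of them
  applies to a word without \<open>C\<close>.\<close>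

lemma idle_step:
  assumes "set z \<subseteq> content" "scm_step grammar z z'" "macro\<^sup>*\<^sup>* x z"
  shows "live x z'"
proof -
  have C: "LC \<notin> set z" using assms LC_content by auto
  \<comment> \<open>A word without \<open>C\<close> is viewed as having an empty block, so that
    \<open>reset_matrix_iff\<close> applies with \<open>n = 0\<close>.\<close>
  have nil: "z = [] @ replicate 0 LC @ z" by simp
  from assms(2) obtain r where r: "r \<in> smats grammar" "mat_step r z z'" by (auto simp: scm_step_def)
  from r(1) show ?thesis
  proof (cases rule: smats_cases)
    case (1 i)
    then obtain p q where pq: "z = p @ Nt (letter i) # q" 
      "z' = p @ replicate (cnt i 0) LC @ Nt (letter i) # q" using r by (auto simp: start_matrix_iff)
    then show ?thesis unfolding live_def using assms 1
      by (intro exI[of _ i] exI[of _ 0] exI[of _ p] exI[of _ q] exI[of _ p] exI[of _ "Nt (letter i) # q"])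
         (auto simp: valid_def)
  next
    case (2 i)
    have "mat_step (reset_matrix i) ([] @ replicate 0 LC @ z) z'" using 2 r nil by simp
    then have "0 = cnt i (length (code i))"
      using reset_matrix_iff[OF 2(1), of "[]" z 0 z'] assms(1) by auto
    then show ?thesis using cnt_pos[of i "length (code i)"] 2 by (auto simp: valid_def)
  next
    case (3 i j)
    then have "\<exists>y. apply_rules (counter_rules (cnt i j) (inc i j)) z y"
      using r(2) by (cases "code i ! j") (auto simp: step_matrix_def mat_step_def apply_rules_append)
    then have "cnt i j \<le> 0" 
      using apply_counter_rules[of "[]" z "cnt i j" "inc i j" 0] C cnt_pos[of i j] 3(1) 
      by (auto simp: valid_def)
    then show ?thesis using cnt_pos[of i j] 3 by (auto simp: valid_def)
  qed
qed

lemma live_run: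
  assumes "valid i j" "run (take j (code i)) (p, q) (u, v)" "set p \<subseteq> content" "set q \<subseteq> content"
  shows "(scm_step grammar)\<^sup>*\<^sup>* (p @ replicate (cnt i 0) LC @ q) (u @ replicate (cnt i j) LC @ v)"
  using assms(1,2)
proof (induction j arbitrary: u v)
  case (Suc j)
  have v: "valid i j" using Suc.prems by (auto simp: valid_def)
  obtain u1 v1 where 1: "run (take j (code i)) (p, q) (u1, v1)" "instr_step (code i ! j) (u1, v1) (u, v)"
    using Suc.prems by (auto simp: take_Suc_conv_app_nth valid_def run_append)
  have "\<forall>x \<in> set (take j (code i)). instr_wf content x"
    using program_wf[of "letter i" "code i"] Suc.prems(1) by (auto simp: valid_def dest: in_set_takeD)
  then have s: "set u1 \<subseteq> content" "set v1 \<subseteq> content" using run_set[OF 1(1)] assms(3,4) by auto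
  have "mat_step (step_matrix i j) (u1 @ replicate (cnt i j) LC @ v1) (u @ replicate (cnt i (Suc j)) LC @ v)"
    using step_matrix_iff[OF Suc.prems(1) s cnt_pos[OF v]] 1(2) cnt_Suc[OF Suc.prems(1)] by auto
  moreover have "step_matrix i j \<in> smats grammar" 
    using Suc.prems(1) by (auto simp: grammar_def valid_def)
  ultimately show ?case using Suc.IH[OF v 1(1)] by (auto simp: scm_step_def intro: rtranclp.rtrancl_into_rtrancl)
qed auto

lemma macro_sound:
  assumes "macro x y" "set x \<subseteq> content"
  shows "(scm_step grammar)\<^sup>*\<^sup>* x y"
proof -
  from assms(1) obtain i p q u v where i: "i < length Ps" and x: "x = p @ Nt (letter i) # q"
     and run: "run (code i) (p, Nt (letter i) # q) (u, v)" and y: "y = u @ v"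
    unfolding macro_def exec_def by (metis in_set_conv_nth)
  let ?q = "Nt (letter i) # q" and ?n = "length (code i)"
  have s: "set p \<subseteq> content" "set ?q \<subseteq> content" using x assms(2) by auto
  have s': "set u \<subseteq> content" "set v \<subseteq> content"
    using run_set[OF run] program_wf[of "letter i" "code i"] i s by auto
  have "scm_step grammar x (p @ replicate (cnt i 0) LC @ ?q)"
    unfolding scm_step_def using i x assms(2) LC_content
    by (intro bexI[of _ "start_matrix i"]) (auto simp: start_matrix_iff grammar_def)
  moreover have "(scm_step grammar)\<^sup>*\<^sup>* (p @ replicate (cnt i 0) LC @ ?q) (u @ replicate (cnt i ?n) LC @ v)"
    using live_run[of i ?n p ?q u v] run s i by (auto simp: valid_def)
  moreover have "scm_step grammar (u @ replicate (cnt i ?n) LC @ v) y"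
    unfolding scm_step_def using i y reset_matrix_iff[OF i s']
    by (intro bexI[of _ "reset_matrix i"]) (auto simp: grammar_def)
  ultimately show ?thesis by (meson converse_rtranclp_into_rtranclp rtranclp.rtrancl_into_rtrancl)
qed

text \<open>Live and dead words contain a block of positive length, whereas \<open>y\<close> has no
  \<open>C\<close>; so a derivation that ends in \<open>y\<close> has completed all its
  programs.\<close>

lemma scm_steps_iff_macros:
  assumes "set x \<subseteq> content" "set y \<subseteq> content"
  shows "(scm_step grammar)\<^sup>*\<^sup>* x y \<longleftrightarrow> macro\<^sup>*\<^sup>* x y"
proof
  assume "(scm_step grammar)\<^sup>*\<^sup>* x y"
  then have "macro\<^sup>*\<^sup>* x y \<or> live x y \<or> dead y"
  proof (induction rule: rtranclp_induct)
    case (step y z)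
    then show ?case using live_step dead_step idle_step macros_set[OF _ assms(1)] by blast
  qed auto
  moreover have "\<not> live x y" 
    using assms(2) LC_content cnt_pos by (fastforce simp: live_def)
  moreover have "\<not> dead y" 
    using assms(2) LC_content by (fastforce simp: dead_def Z_def)
  ultimately show "macro\<^sup>*\<^sup>* x y" by blast
next
  assume "macro\<^sup>*\<^sup>* x y"
  then show "(scm_step grammar)\<^sup>*\<^sup>* x y"
  proof (induction rule: rtranclp_induct)
    case (step y z)
    then show ?case using macro_sound macros_set[OF step(1) assms(1)] by (meson rtranclp_trans)
  qed auto
qed

end

section \<open>Simulating productions\<close>

text \<open>Using \<open>k + 1\<close> instead of \<open>k\<close> letters makes every nonterminal
  code begin with \<open>A\<close>. So no code begins with \<open>B\<close>, and the block can
  always be opened in front of a nonterminal.\<close>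

fun enc_sym :: "'a sym \<Rightarrow> 'a sym list" where
  "enc_sym (Tm a) = [Tm a]"
| "enc_sym (Nt k) = replicate (Suc k) LA @ [LB]"

definition enc :: "'a sym list \<Rightarrow> 'a sym list" where
  "enc w = concat (map enc_sym w)"

lemma enc_simps [simp]:
  "enc [] = []" "enc (s # w) = enc_sym s @ enc w" "enc (v @ w) = enc v @ enc w"
  by (auto simp: enc_def)

lemma enc_not_LB: "\<not> prefix [LB] (enc w)"
  by (cases w; cases "hd w") auto

text \<open>The tests \<open>j \<le> k\<close> leave at least \<open>k + 1\<close> letters \<open>A\<close> behind the block; deleting exactly \<open>k + 1\<close> letters
  so that no \<open>A\<close> follows the block is then possible for the code of \<open>k\<close> only.\<close>

definition pop :: "'a list \<Rightarrow> nat \<Rightarrow> 'a sym list \<Rightarrow> 'a instr list" where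
  "pop ts k w =
     map (\<lambda>t. Test (NotRight [Tm t])) ts @
     map (\<lambda>j. Test (NotRight (replicate j LA @ [LB]))) [0..<Suc k] @
     [Repl (Suc k) 0 [], Test (NotRight [LA]), Repl 1 1 w, Test (NotRight [LB])]"

text \<open>The right-hand side replaces the \<open>B\<close> of the last code only; before that,
  the next code of the left-hand side must stand directly at the block.\<close>

fun pops :: "'a list \<Rightarrow> nat list \<Rightarrow> 'a sym list \<Rightarrow> 'a instr list" where
  "pops ts [] w = []"
| "pops ts (k # ks) w = pop ts k (if ks = [] then w else []) @ pops ts ks w"

lemma run_tests:
  "run (map (\<lambda>x. Test (f x)) xs) s t \<longleftrightarrow> s = t \<and> (\<forall>x \<in> set xs. test_ok (f x) s)"
  by (induction xs) auto

lemma replicate_occurrence: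
  assumes "replicate j x @ y # s = p @ x # q" "x \<noteq> y"
  shows "(\<exists>i. j = Suc i \<and> p @ q = replicate i x @ y # s) \<or>
    (\<exists>p'. p = replicate j x @ y # p' \<and> s = p' @ x # q)"
  using assms
proof (induction j arbitrary: p)
  case 0
  then show ?case by (cases p) auto
next
  case (Suc j)
  show ?case
  proof (cases p)
    case Nil
    then show ?thesis using Suc.prems by auto
  next
    case (Cons a p')
    then have "replicate j x @ y # s = p' @ x # q" "a = x" using Suc.prems by auto
    from Suc.IH[OF this(1) Suc.prems(2)] show ?thesis using Cons \<open>a = x\<close> by auto
  qed
qed

text \<open>Only a deletion inside the leading run shortens it, by one each time. So the run loses
  \<open>k\<close> letters only if all \<open>k\<close> deletions hit it, and then everything else
  is unchanged.\<close>

lemma delete_run: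
  assumes "pair_rules (replicate k (0, [])) (u, replicate j LA @ LB # s) (u', v')"
  shows "\<exists>j' s'. v' = replicate j' LA @ LB # s' \<and> j' \<le> j \<and> j \<le> j' + k \<and>
    (j = j' + k \<longrightarrow> u' = u \<and> s' = s)"
  using assms
proof (induction k arbitrary: u j s)
  case (Suc k)
  then consider p q where "u = p @ LA # q"
      "pair_rules (replicate k (0, [])) (p @ q, replicate j LA @ LB # s) (u', v')"
    | p q where "replicate j LA @ LB # s = p @ LA # q"
      "pair_rules (replicate k (0, [])) (u, p @ q) (u', v')"
    by auto
  then show ?case
  proof cases
    case 1
    from Suc.IH[OF 1(2)] show ?thesis by fastforce
  next
    case 2
    from replicate_occurrence[OF 2(1)] consider i where "j = Suc i" "p @ q = replicate i LA @ LB # s"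
      | p' where "p = replicate j LA @ LB # p'" "s = p' @ LA # q" by auto
    then show ?thesis
    proof cases
      case 1
      from Suc.IH[of u i s] 2 1 show ?thesis by fastforce
    next
      case right: 2
      from Suc.IH[of u j "p' @ q"] 2 right show ?thesis by fastforce
    qed
  qed
qed auto

lemma delete_run_all:
  "pair_rules (replicate k (0, [])) (u, replicate k LA @ LB # s) (u, LB # s)"
proof (induction k)
  case (Suc k)
  then show ?case
    unfolding replicate_Suc pair_rules.simps
    by (intro disjI2 exI[of _ "[]"] exI[of _ "replicate k LA @ LB # s"]) simp
qed auto

text \<open>The tests exclude terminals and codes of index below \<open>k\<close> at the front, and
  \<open>k + 1\<close> deletions can clear the leading run only if the index is at most
  \<open>k\<close>. The last test forces the \<open>B\<close> rule to hit the \<open>B\<close> left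
  over at the block.\<close>

lemma run_pop:
  assumes z: "z \<noteq> []" "last z = Nt K" "k < K" "\<And>t. Tm t \<in> set z \<Longrightarrow> t \<in> set ts"
  shows "run (pop ts k (enc b)) (u, enc z) s \<longleftrightarrow> (\<exists>z'. z = Nt k # z' \<and> s = (u, enc (b @ z')))"
proof
  assume r: "run (pop ts k (enc b)) (u, enc z) s"
  obtain u3 v3 where s: "s = (u3, v3)" by force
  from r obtain u1 v1 where
    t1: "\<And>t. t \<in> set ts \<Longrightarrow> \<not> prefix [Tm t] (enc z)"
    and t2: "\<And>j. j \<le> k \<Longrightarrow> \<not> prefix (replicate j LA @ [LB]) (enc z)"
    and d: "pair_rules (replicate (Suc k) (0, [])) (u, enc z) (u1, v1)"
    and t3: "\<not> prefix [LA] v1"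
    and d': "pair_rules (replicate 1 (1, enc b)) (u1, v1) (u3, v3)"
    and t4: "\<not> prefix [LB] v3"
    unfolding pop_def run_append run_tests s
    by (auto simp del: pair_rules.simps replicate.simps upt_Suc simp: less_Suc_eq_le)
  obtain y z' where y: "z = y # z'" using z(1) by (cases z) auto
  obtain m where m: "y = Nt m"
  proof (cases y)
    case (Tm t)
    then have "t \<in> set ts" "prefix [Tm t] (enc z)" using z(4) y by auto
    then show ?thesis using t1 by blast
  qed
  have ez: "enc z = replicate (Suc m) LA @ LB # enc z'" using y m by simp
  \<comment> \<open>The word begins with \<open>A^(m+1) B\<close>, which is one of the forbidden
    words unless \<open>m + 1 > k\<close>.\<close>
  have "k < Suc m"
  proof (rule ccontr)
    assume "\<not> k < Suc m"
    then show False using t2[of "Suc m"] ez by (auto simp: prefix_def)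
  qed
  from delete_run[OF d[unfolded ez]] obtain j' s' where j: "v1 = replicate j' LA @ LB # s'"
    "Suc m \<le> j' + Suc k" "Suc m = j' + Suc k \<longrightarrow> u1 = u \<and> s' = enc z'" by blast
  have "j' = 0" using t3 j(1) by (cases j') auto
  \<comment> \<open>All \<open>k + 1\<close> deletions were spent on the leading run, so
    \<open>u\<close> and the rest are untouched.\<close>
  with j \<open>k < Suc m\<close> have "m = k" and uv: "u1 = u" "v1 = LB # enc z'" by auto
  from d' uv have "u3 = u \<and> v3 = enc b @ enc z'"
  proof -
    from d' uv consider p q where "v3 = LB # enc z'" 
      | p q where "LB # enc z' = p @ LB # q" "u3 = u" "v3 = p @ enc b @ q" by auto
    then show ?thesis
    proof cases
      case (2 p q)
      then show ?thesis using t4 by (cases p) auto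
    qed (use t4 in auto)
  qed
  then show "\<exists>z'. z = Nt k # z' \<and> s = (u, enc (b @ z'))" using s y m \<open>m = k\<close> by auto
next
  assume "\<exists>z'. z = Nt k # z' \<and> s = (u, enc (b @ z'))"
  then obtain z' where z': "z = Nt k # z'" and s: "s = (u, enc b @ enc z')" by auto
  have ez: "enc z = replicate (Suc k) LA @ LB # enc z'" using z' by simp
  have t2: "\<not> prefix (replicate j LA @ [LB]) (enc z)" if "j < Suc k" for j
  proof -
    have "Suc k = j + Suc (k - j)" using that by simp
    then have "replicate (Suc k) LA = replicate j LA @ replicate (Suc (k - j)) LA"
      by (metis replicate_add)
    then have "enc z = replicate j LA @ LA # replicate (k - j) LA @ LB # enc z'"
      unfolding ez by simp
    then show ?thesis by auto
  qed
  have "pair_rules (replicate (Suc k) (0, [])) (u, enc z) (u, LB # enc z')"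
    unfolding ez by (rule delete_run_all)
  moreover have "pair_rules (replicate 1 (1, enc b)) (u, LB # enc z') s"
    unfolding s One_nat_def replicate_Suc pair_rules.simps
    by (intro disjI2 exI[of _ "[]"] exI[of _ "enc z'"]) simp
  moreover have "\<not> prefix [LB] (enc b @ enc z')" using enc_not_LB[of "b @ z'"] by simp
  ultimately have "run [Repl (Suc k) 0 [], Test (NotRight [LA]), Repl 1 1 (enc b), Test (NotRight [LB])]
      (u, enc z) s"
    unfolding run.simps instr_step.simps s
    by (intro exI[of _ "(u, LB # enc z')"] exI[of _ "(u, enc b @ enc z')"] conjI refl) simp_all
  then show "run (pop ts k (enc b)) (u, enc z) s"
    unfolding pop_def run_append run_tests using t2 ez
    by (intro exI[of _ "(u, enc z)"]) (simp del: run.simps)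
qed

text \<open>Each removed symbol differs from the sentinel, so the remaining word is nonempty and
  still ends with the sentinel, as the induction requires.\<close>

lemma run_pops:
  assumes "ks \<noteq> []" "z \<noteq> []" "last z = Nt K" "\<forall>k \<in> set ks. k < K"
    "\<And>t. Tm t \<in> set z \<Longrightarrow> t \<in> set ts"
  shows "run (pops ts ks (enc b)) (u, enc z) s \<longleftrightarrow>
    (\<exists>z'. z = map Nt ks @ z' \<and> s = (u, enc (b @ z')))"
  using assms
proof (induction ks arbitrary: z)
  case (Cons k ks)
  show ?case
  proof (cases "ks = []")
    case True
    then show ?thesis using run_pop[of z K k ts b u s] Cons.prems by simp
  next
    case False
    have *: "run (pop ts k []) (u, enc z) s' \<longleftrightarrow> (\<exists>z'. z = Nt k # z' \<and> s' = (u, enc z'))" for s'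
      using run_pop[of z K k ts "[]" u s'] Cons.prems by simp
    have "run (pops ts (k # ks) (enc b)) (u, enc z) s \<longleftrightarrow>
      (\<exists>z'. z = Nt k # z' \<and> run (pops ts ks (enc b)) (u, enc z') s)"
      using False by (auto simp: run_append *)
    also have "\<dots> \<longleftrightarrow> (\<exists>z'. z = Nt k # z' \<and> (\<exists>z''. z' = map Nt ks @ z'' \<and> s = (u, enc (b @ z''))))"
    proof (intro ex_cong1 conj_cong refl)
      fix z' assume z': "z = Nt k # z'"
      then have "z' \<noteq> []" using Cons.prems by auto
      then show "run (pops ts ks (enc b)) (u, enc z') s =
         (\<exists>z''. z' = map Nt ks @ z'' \<and> s = (u, enc (b @ z'')))"
        using z' False Cons.prems by (intro Cons.IH) auto
    qed
    finally show ?thesis by auto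
  qed
qed simp

text \<open>The initial test places the block at the beginning of a code and not inside a run of
  \<open>A\<close>s.\<close>

definition prod_program :: "'a list \<Rightarrow> nat list \<Rightarrow> 'a sym list \<Rightarrow> nat \<times> 'a instr list" where
  "prod_program ts ks b = (0, Test (NotLeft [LA]) # pops ts ks (enc b))"

text \<open>Inside a code every \<open>A\<close> but the first is preceded by another
  \<open>A\<close>, so the test on the left leaves only code boundaries.\<close>

lemma enc_split_at_LA:
  assumes "enc z = p @ LA # q" "\<not> suffix [LA] p"
  shows "\<exists>z1 z2. z = z1 @ z2 \<and> p = enc z1 \<and> LA # q = enc z2 \<and> z2 \<noteq> []"
  using assms
proof (induction z arbitrary: p)
  case (Cons s z)
  show ?case
  proof (cases "p = []")
    case True
    then show ?thesis using Cons.prems by (intro exI[of _ "[]"] exI[of _ "s # z"]) auto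
  next
    case False
    have "\<exists>p'. p = enc_sym s @ p' \<and> enc z = p' @ LA # q"
    proof (cases s)
      case (Tm a)
      then show ?thesis using Cons.prems False by (cases p) auto
    next
      case (Nt k)
      have eq: "replicate (Suc k) LA @ LB # enc z = p @ LA # q" using Cons.prems Nt by simp
      \<comment> \<open>As \<open>p\<close> is nonempty, it would end with \<open>A\<close> if it
        were a part of the leading run.\<close>
      have "\<nexists>i r. i \<le> k \<and> p = replicate i LA"
      proof
        assume "\<exists>i r. i \<le> k \<and> p = replicate i LA"
        then obtain i where "p = replicate i LA" by blast
        with False have "suffix [LA] p" 
          by (cases i) (auto simp: suffix_def replicate_append_same[symmetric])
        with Cons.prems show False by blast
      qed
      moreover have "(\<exists>i \<le> k. p = replicate i LA) \<or> (\<exists>p'. p = replicate (Suc k) LA @ LB # p' \<and> enc z = p' @ LA # q)"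
        using eq
      proof (induction k arbitrary: p)
        case 0
        then show ?case by (auto simp: Cons_eq_append_conv)
      next
        case (Suc k)
        show ?case
        proof (cases p)
          case (Cons a p')
          then have "replicate (Suc k) LA @ LB # enc z = p' @ LA # q" "a = LA" using Suc.prems by auto
          from Suc.IH[OF this(1)] show ?thesis using Cons \<open>a = LA\<close> 
            by (auto intro: exI[of _ "Suc _"])
        qed auto
      qed
      ultimately show ?thesis using Nt by auto
    qed
    then obtain p' where p': "p = enc_sym s @ p'" "enc z = p' @ LA # q" by blast
    then have "\<not> suffix [LA] p'" using Cons.prems by (auto simp: suffix_def)
    from Cons.IH[OF p'(2) this] obtain z1 z2 where "z = z1 @ z2" "p' = enc z1" "LA # q = enc z2" "z2 \<noteq> []"
      by blast
    then show ?thesis using p' by (intro exI[of _ "s # z1"] exI[of _ z2]) auto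
  qed
qed auto

lemma enc_not_suffix_LA: "\<not> suffix [LA] (enc z)"
proof (cases z rule: rev_cases)
  case (snoc z' s)
  then show ?thesis by (cases s) (auto simp: suffix_def)
qed auto

text \<open>Since \<open>K\<close> does not occur in the left-hand side, the sentinel survives and
  the removed occurrence lies inside \<open>y\<close>.\<close>

lemma exec_prod_program:
  assumes "ks \<noteq> []" "\<forall>k \<in> set ks. k < K" "\<And>t. Tm t \<in> set y \<Longrightarrow> t \<in> set ts"
  shows "exec (prod_program ts ks b) (enc (y @ [Nt K])) x \<longleftrightarrow>
    (\<exists>y1 y2. y = y1 @ map Nt ks @ y2 \<and> x = enc (y1 @ b @ y2 @ [Nt K]))"
proof
  assume "exec (prod_program ts ks b) (enc (y @ [Nt K])) x"
  then obtain p q u v where e: "enc (y @ [Nt K]) = p @ LA # q" "\<not> suffix [LA] p"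
    and r: "run (pops ts ks (enc b)) (p, LA # q) (u, v)" and x: "x = u @ v"
    by (auto simp: exec_def prod_program_def simp del: enc_simps)
  from enc_split_at_LA[OF e] obtain z1 z2 where z: "y @ [Nt K] = z1 @ z2" "p = enc z1"
    "LA # q = enc z2" "z2 \<noteq> []" by blast
  have l: "last z2 = Nt K" using z(1,4) by (metis last_appendR last_snoc)
  have "t \<in> set ts" if "Tm t \<in> set z2" for t
  proof -
    have "Tm t \<in> set (y @ [Nt K])" unfolding z(1) using that by simp
    then show ?thesis using assms(3) by simp
  qed
  with run_pops[OF assms(1) z(4) l assms(2)] r z(3) obtain z' where
    z': "z2 = map Nt ks @ z'" "u = p" "v = enc (b @ z')" by (metis prod.inject)
  have "z' \<noteq> []"
  proof
    assume "z' = []"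
    moreover have "Nt K \<in> set z2" using l z(4) by (metis last_in_set)
    ultimately show False using assms(2) z' by auto
  qed
  then obtain y2 where y2: "z' = y2 @ [Nt K]" using l z' by (metis append_butlast_last_id last_appendR)
  then have "y = z1 @ map Nt ks @ y2" using z(1) z'(1)
    by (metis append.assoc butlast_snoc)
  then show "\<exists>y1 y2. y = y1 @ map Nt ks @ y2 \<and> x = enc (y1 @ b @ y2 @ [Nt K])"
    using x z' z(2) y2 by (intro exI[of _ z1] exI[of _ y2]) simp
next
  assume "\<exists>y1 y2. y = y1 @ map Nt ks @ y2 \<and> x = enc (y1 @ b @ y2 @ [Nt K])"
  then obtain y1 y2 where y: "y = y1 @ map Nt ks @ y2" and x: "x = enc (y1 @ b @ y2 @ [Nt K])" by blast
  let ?z = "map Nt ks @ y2 @ [Nt K]"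
  have "run (pops ts ks (enc b)) (enc y1, enc ?z) (enc y1, enc (b @ y2 @ [Nt K]))"
    using run_pops[of ks ?z K ts b "enc y1"] assms y by auto
  moreover obtain q where "enc ?z = LA # q" using assms(1) by (cases ks) auto
  ultimately show "exec (prod_program ts ks b) (enc (y @ [Nt K])) x"
    unfolding exec_def using enc_not_suffix_LA[of y1] x y
    by (intro exI[of _ "enc y1"] exI[of _ q] exI[of _ "enc (b @ y2 @ [Nt K])"])
       (auto simp: prod_program_def)
qed

section \<open>Programs that end and begin a derivation\<close>

definition final_program :: "nat \<Rightarrow> nat \<times> 'a instr list" where
  "final_program K = (0, [Repl (Suc K) 0 [], Test (Absent 0), Repl 1 1 [], Test (Absent 1)])"

text \<open>Deletions may hit either side at any place; these two quantities of the concatenated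
  word do not depend on that choice.\<close>

lemma delete_pair:
  assumes "pair_rules (replicate k (a, [])) (u, v) (u', v')"
  shows "filter (\<lambda>s. s \<noteq> Nt a) (u' @ v') = filter (\<lambda>s. s \<noteq> Nt a) (u @ v)
    \<and> count_list (u @ v) (Nt a) = count_list (u' @ v') (Nt a) + k"
  using assms
proof (induction k arbitrary: u v)
  case (Suc k)
  then consider p q where "u = p @ Nt a # q" "pair_rules (replicate k (a, [])) (p @ q, v) (u', v')"
    | p q where "v = p @ Nt a # q" "pair_rules (replicate k (a, [])) (u, p @ q) (u', v')" by auto
  then show ?case by cases (use Suc.IH in force)+
qed auto

lemma enc_map_Tm [simp]: "enc (map Tm w) = map Tm w"
  by (induction w) auto

lemma count_enc_pos: "Nt k \<in> set y \<Longrightarrow> count_list (enc y) LA > 0"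
  by (induction y) auto

text \<open>The sentinel alone contributes \<open>K + 1\<close> letters \<open>A\<close>. Exactly
  that many are deleted and none remains, so \<open>y\<close> has no nonterminal and the only
  \<open>B\<close> is that of the sentinel.\<close>

lemma exec_final_program:
  "exec (final_program K) (enc (y @ [Nt K])) x \<longleftrightarrow> (\<exists>w. y = map Tm w \<and> x = map Tm w)"
proof
  assume "exec (final_program K) (enc (y @ [Nt K])) x"
  then obtain p q u v u1 v1 where e: "enc (y @ [Nt K]) = p @ LA # q" 
    and d1: "pair_rules (replicate (Suc K) (0, [])) (p, LA # q) (u1, v1)" and a1: "LA \<notin> set (u1 @ v1)"
    and d2: "pair_rules (replicate 1 (1, [])) (u1, v1) (u, v)" and a2: "LB \<notin> set (u @ v)"
    and x: "x = u @ v"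
    by (auto simp: exec_def final_program_def simp del: enc_simps pair_rules.simps replicate.simps)
  have cK: "count_list (replicate n LA) LA = n" for n by (induction n) auto
  note D1 = delete_pair[OF d1, folded e] and D2 = delete_pair[OF d2]
  have "count_list (u1 @ v1) LA = 0" using a1 by (simp only: count_list_0_iff not_False_eq_True)
  then have "count_list (enc y) LA + Suc K = Suc K" using D1 by (simp add: cK)
  then have "Nt k \<notin> set y" for k using count_enc_pos[of k y] by auto
  then have "\<exists>w. y = map Tm w"
  proof (induction y)
    case (Cons s y)
    then obtain w where "y = map Tm w" by (metis list.set_intros(2))
    moreover have "\<exists>t. s = Tm t" using Cons.prems by (cases s) auto
    ultimately show ?case by (metis list.map(2))
  qed auto
  then obtain w where w: "y = map Tm w" by blast
  have "u1 @ v1 = filter (\<lambda>s. s \<noteq> LA) (u1 @ v1)" using a1 by (metis (mono_tags, lifting) filter_True)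
  also have "\<dots> = map Tm w @ [LB]" using D1 w by (simp add: filter_map o_def)
  finally have 1: "u1 @ v1 = map Tm w @ [LB]" .
  have "u @ v = filter (\<lambda>s. s \<noteq> LB) (u @ v)" using a2 by (metis (mono_tags, lifting) filter_True)
  also have "\<dots> = map Tm w" using D2 1 by (simp add: filter_map o_def)
  finally show "\<exists>w. y = map Tm w \<and> x = map Tm w" using w x by blast
next
  assume "\<exists>w. y = map Tm w \<and> x = map Tm w"
  then obtain w where w: "y = map Tm w" "x = map Tm w" by blast
  have "pair_rules (replicate (Suc K) (0, [])) (map Tm w, replicate (Suc K) LA @ [LB]) (map Tm w, [LB])"
    by (rule delete_run_all)
  moreover have "pair_rules (replicate 1 (1, [])) (map Tm w, [LB]) (map Tm w, [])"
    unfolding One_nat_def replicate_Suc pair_rules.simps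
    by (intro disjI2 exI[of _ "[]"]) simp
  ultimately have "run (snd (final_program K)) (map Tm w, replicate (Suc K) LA @ [LB]) (map Tm w, [])"
    unfolding final_program_def snd_conv run.simps instr_step.simps
    by (intro exI[of _ "(map Tm w, [LB])"] exI[of _ "(map Tm w, [])"] conjI refl) auto
  then show "exec (final_program K) (enc (y @ [Nt K])) x"
    unfolding exec_def using w
    by (intro exI[of _ "map Tm w"] exI[of _ "replicate K LA @ [LB]"] exI[of _ "[]"])
       (simp add: final_program_def)
qed

text \<open>\<open>Absent 0\<close> rejects every code that carries a sentinel, since such a code
  contains \<open>A\<close>; the later \<open>Absent 1\<close> demands that the replaced
  \<open>B\<close> was the only one.\<close>

definition init_program :: "'a sym list \<Rightarrow> nat \<times> 'a instr list" where
  "init_program w = (1, [Test (Absent 0), Repl 1 1 [LA], Test (Absent 1), Repl 1 0 w])"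

lemma exec_init_program: "exec (init_program w) [LB] x \<longleftrightarrow> x = w"
  by (auto simp: exec_def init_program_def Cons_eq_append_conv append_eq_Cons_conv)

lemma exec_init_program_LA: "LA \<in> set x \<Longrightarrow> \<not> exec (init_program w) x y"
  by (auto simp: exec_def init_program_def simp del: pair_rules.simps replicate.simps)

section \<open>From nonterminal left-hand sides to an SCM grammar\<close>

lemma exec_letter: "exec P x y \<Longrightarrow> Nt (fst P) \<in> set x"
  by (auto simp: exec_def)

lemma ps_step_set:
  assumes "ps_wf G" "ps_step G x y" "set x \<subseteq> alph (pterms G) (pnonterms G)"
  shows "set y \<subseteq> alph (pterms G) (pnonterms G)"
  using assms unfolding ps_wf_def ps_step_def by fastforce

lemma ps_steps_set:
  assumes "ps_wf G" "(ps_step G)\<^sup>*\<^sup>* x y" "set x \<subseteq> alph (pterms G) (pnonterms G)"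
  shows "set y \<subseteq> alph (pterms G) (pnonterms G)"
  using assms(2,3) by (induction rule: rtranclp_induct) (auto dest: ps_step_set[OF assms(1)])

lemma enc_set: "set w \<subseteq> alph T N \<Longrightarrow> set (enc w) \<subseteq> alph T {0, 1}"
proof (induction w)
  case (Cons s w)
  then show ?case by (cases s) (auto simp: alph_def)
qed auto

lemma pops_wf:
  assumes "set w \<subseteq> alph (set ts) {0, 1}" "i \<in> set (pops ts ks w)"
  shows "instr_wf (alph (set ts) {0, 1}) i"
  using assms(2)
proof (induction ks)
  case (Cons k ks)
  then show ?case using assms(1) by (auto simp: pop_def alph_def split: if_splits)
qed auto

text \<open>A sequence of program executions passes through three phases: the start word
  \<open>B\<close>, codes of sentential forms with the sentinel, and terminal words, in which no
  program can start.\<close>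

lemma nonterminal_lhs_in_SSCM:
  assumes wf: "ps_wf G" and nf: "\<And>\<alpha> \<beta>. (\<alpha>, \<beta>) \<in> prods G \<Longrightarrow> \<exists>ks. \<alpha> = map Nt ks"
  shows "ps_lang G \<in> SSCM_0_star_3"
proof -
  define V where "V = alph (pterms G) (pnonterms G)"
  \<comment> \<open>A number above all nonterminals of \<open>G\<close>, so the sentinel differs
    from each of them.\<close>
  define K where "K = Suc (Max (pnonterms G))"
  define S where "S = pstart G"
  \<comment> \<open>The value 0 at terminals is a mere default; left-hand sides consist of
    nonterminals.\<close>
  define nt where "nt = map (\<lambda>s :: 'a sym. case s of Nt k \<Rightarrow> k | Tm _ \<Rightarrow> 0)"
  have finG: "finite (pterms G)" "finite (pnonterms G)" "finite (prods G)" "S \<in> pnonterms G"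
    using wf by (auto simp: ps_wf_def S_def)
  obtain ts where ts: "set ts = pterms G" using finG finite_list by blast
  obtain pl where pl: "set pl = prods G" using finG finite_list by blast
  have K: "k < K" if "k \<in> pnonterms G" for k using that finG by (simp add: K_def less_Suc_eq_le)
  have nt: "map Nt (nt \<alpha>) = \<alpha>" "nt \<alpha> \<noteq> []" "\<forall>k \<in> set (nt \<alpha>). k < K" "set \<beta> \<subseteq> V"
    if ab: "(\<alpha>, \<beta>) \<in> prods G" for \<alpha> \<beta>
  proof -
    obtain ks where ks: "\<alpha> = map Nt ks" using nf ab by blast
    then have n: "nt \<alpha> = ks" by (simp add: nt_def o_def)
    have "set \<alpha> \<subseteq> V" "set \<beta> \<subseteq> V" "\<exists>A. Nt A \<in> set \<alpha>" using wf ab by (auto simp: ps_wf_def V_def)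
    then show "map Nt (nt \<alpha>) = \<alpha>" "nt \<alpha> \<noteq> []" "\<forall>k \<in> set (nt \<alpha>). k < K" "set \<beta> \<subseteq> V"
      using ks n K by (auto simp: V_def alph_def)
  qed
  define Ps where "Ps = init_program (enc [Nt S, Nt K]) # final_program K #
    map (\<lambda>(\<alpha>, \<beta>). prod_program ts (nt \<alpha>) \<beta>) pl"
  have Ps: "set Ps = insert (init_program (enc [Nt S, Nt K])) (insert (final_program K)
    ((\<lambda>(\<alpha>, \<beta>). prod_program ts (nt \<alpha>) \<beta>) ` prods G))" by (auto simp: Ps_def pl)
  interpret programs "pterms G" Ps
  proof
    fix a :: nat and "is" assume "(a, is) \<in> set Ps"
    then consider "(a, is) = init_program (enc [Nt S, Nt K])" | "(a, is) = final_program K"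
      | \<alpha> \<beta> where "(\<alpha>, \<beta>) \<in> prods G" "(a, is) = prod_program ts (nt \<alpha>) \<beta>" unfolding Ps by auto
    then show "a \<in> {0, 1} \<and> (\<forall>i \<in> set is. instr_wf (alph (pterms G) {0, 1}) i)"
    proof cases
      case 1
      then show ?thesis by (auto simp: init_program_def alph_def)
    next
      case 2
      then show ?thesis by (auto simp: final_program_def alph_def)
    next
      case 3
      then have "set (enc \<beta>) \<subseteq> alph (set ts) {0, 1}" using nt(4) enc_set unfolding V_def ts by blast
      then show ?thesis using 3 pops_wf[of "enc \<beta>" ts _ "nt \<alpha>"] 
        by (auto simp: prod_program_def ts alph_def[of _ "{0, Suc 0}"])
    qed
  qed (use finG in simp)
  have VS: "set [Nt S] \<subseteq> V" using finG by (auto simp: V_def alph_def)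
  have macro_iff: "macro z x \<longleftrightarrow> exec (init_program (enc [Nt S, Nt K])) z x \<or> exec (final_program K) z x \<or>
      (\<exists>(\<alpha>, \<beta>) \<in> prods G. exec (prod_program ts (nt \<alpha>) \<beta>) z x)" for z x
    unfolding macro_def Ps by auto
  have init: "macro [LB] x \<longleftrightarrow> x = enc [Nt S, Nt K]" for x
    unfolding macro_iff exec_init_program
    using exec_letter[of "final_program K" "[LB]" x] exec_letter[of "prod_program ts _ _" "[LB]" x]
    by (auto simp: final_program_def prod_program_def simp del: enc_simps)
  have macro_enc: "macro (enc (y @ [Nt K])) x \<longleftrightarrow> (\<exists>w. y = map Tm w \<and> x = map Tm w) \<or>
      (\<exists>y'. ps_step G y y' \<and> x = enc (y' @ [Nt K]))" if y: "set y \<subseteq> V" for x y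
  proof -
    have LA: "LA \<in> set (enc (y @ [Nt K]))" by auto
    have t: "\<And>t. Tm t \<in> set y \<Longrightarrow> t \<in> set ts" using y by (auto simp: V_def alph_def ts)
    have "exec (prod_program ts (nt \<alpha>) \<beta>) (enc (y @ [Nt K])) x \<longleftrightarrow>
        (\<exists>y1 y2. y = y1 @ \<alpha> @ y2 \<and> x = enc ((y1 @ \<beta> @ y2) @ [Nt K]))" if "(\<alpha>, \<beta>) \<in> prods G" for \<alpha> \<beta>
      using exec_prod_program[OF nt(2,3)[OF that] t] nt(1)[OF that] by (simp del: enc_simps)
    then have "(\<exists>(\<alpha>, \<beta>) \<in> prods G. exec (prod_program ts (nt \<alpha>) \<beta>) (enc (y @ [Nt K])) x) \<longleftrightarrow>
      (\<exists>y'. ps_step G y y' \<and> x = enc (y' @ [Nt K]))"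
      unfolding ps_step_def by (fastforce simp del: enc_simps)
    then show ?thesis unfolding macro_iff exec_final_program using exec_init_program_LA[OF LA] by blast
  qed
  have reach: "macro\<^sup>*\<^sup>* [LB] z \<Longrightarrow> z = [LB] \<or> (\<exists>y. z = enc (y @ [Nt K]) \<and> (ps_step G)\<^sup>*\<^sup>* [Nt S] y) \<or>
      (\<exists>w. z = map Tm w \<and> (ps_step G)\<^sup>*\<^sup>* [Nt S] (map Tm w))" for z
  proof (induction rule: rtranclp_induct)
    case (step z z')
    from step.IH consider "z = [LB]" | y where "z = enc (y @ [Nt K])" "(ps_step G)\<^sup>*\<^sup>* [Nt S] y"
      | w where "z = map Tm w" by blast
    then show ?case
    proof cases
      case 1
      then have "z' = enc ([Nt S] @ [Nt K])" using init step.hyps by simp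
      then show ?thesis by blast
    next
      case 2
      then have "set y \<subseteq> V" using ps_steps_set[OF wf] VS unfolding V_def by blast
      then show ?thesis using 2 \<open>macro z z'\<close> macro_enc
        by (metis rtranclp.rtrancl_into_rtrancl)
    next
      case 3
      then have "Nt (fst P) \<notin> set z" for P :: "nat \<times> 'a instr list" by auto
      then show ?thesis using step.hyps(2) exec_letter unfolding macro_def by blast
    qed
  qed auto
  have lift: "(ps_step G)\<^sup>*\<^sup>* [Nt S] y \<Longrightarrow> macro\<^sup>*\<^sup>* [LB] (enc (y @ [Nt K]))" for y
  proof (induction rule: rtranclp_induct)
    case base
    then show ?case using init[of "enc [Nt S, Nt K]"] by auto
  next
    case (step y z)
    then have "set y \<subseteq> V" using ps_steps_set[OF wf] VS unfolding V_def by blast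
    then have "macro (enc (y @ [Nt K])) (enc (z @ [Nt K]))" using step.hyps macro_enc
      by blast
    then show ?case using step.IH by (rule rtranclp.rtrancl_into_rtrancl[rotated])
  qed
  have "scm_lang grammar = ps_lang G"
  proof -
    have "(scm_step grammar)\<^sup>*\<^sup>* [LB] (map Tm w) \<longleftrightarrow> (ps_step G)\<^sup>*\<^sup>* [Nt S] (map Tm w)"
      if w: "set w \<subseteq> pterms G" for w
    proof -
      have "set [LB] \<subseteq> content" "set (map Tm w) \<subseteq> content" using w by (auto simp: alph_def)
      then have "(scm_step grammar)\<^sup>*\<^sup>* [LB] (map Tm w) \<longleftrightarrow> macro\<^sup>*\<^sup>* [LB] (map Tm w)"
        by (rule scm_steps_iff_macros)
      also have "\<dots> \<longleftrightarrow> (ps_step G)\<^sup>*\<^sup>* [Nt S] (map Tm w)"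
      proof
        assume m: "macro\<^sup>*\<^sup>* [LB] (map Tm w)"
        have n: "Nt k \<notin> set (map Tm w)" for k by auto
        have "LB \<in> set [LB]" "LB \<in> set (enc (y @ [Nt K]))" for y by auto
        \<comment> \<open>A terminal word contains no \<open>B\<close>, which excludes the first two
          phases.\<close>
        with n have "map Tm w \<noteq> [LB]" "map Tm w \<noteq> enc (y @ [Nt K])" for y by metis+
        then show "(ps_step G)\<^sup>*\<^sup>* [Nt S] (map Tm w)" using reach[OF m] by metis
      next
        assume d: "(ps_step G)\<^sup>*\<^sup>* [Nt S] (map Tm w)"
        then have "set (map Tm w) \<subseteq> V" using ps_steps_set[OF wf] VS unfolding V_def by blast
        then have "macro (enc (map Tm w @ [Nt K])) (map Tm w)" using macro_enc by blast
        then show "macro\<^sup>*\<^sup>* [LB] (map Tm w)" using lift[OF d] by (rule rtranclp.rtrancl_into_rtrancl[rotated])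
      qed
      finally show ?thesis .
    qed
    then show ?thesis unfolding scm_lang_def ps_lang_def S_def by (auto simp: grammar_def)
  qed
  moreover have "card (snonterms grammar) \<le> 3" by (simp add: grammar_def)
  ultimately show ?thesis unfolding SSCM_0_star_3_def using grammar_wf by blast
qed

text \<open>Every symbol, terminals included, gets a nonterminal of the new grammar as a stand-in,
  and rules that turn the stand-in of a terminal into that terminal are added.\<close>

lemma nonterminal_lhs_normal_form:
  assumes wf: "ps_wf G"
  obtains G' where "ps_wf G'" "ps_lang G' = ps_lang G"
    "\<And>\<alpha> \<beta>. (\<alpha>, \<beta>) \<in> prods G' \<Longrightarrow> \<exists>ks. \<alpha> = map Nt ks"
proof -
  define V where "V = alph (pterms G) (pnonterms G)"
  have "finite V" using wf by (simp add: V_def alph_def ps_wf_def)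
  then obtain f :: "'a sym \<Rightarrow> nat" where f: "inj_on f V"
    using finite_imp_inj_to_nat_seg by blast
  define c where "c = map (\<lambda>s. Nt (f s) :: 'a sym)"
  \<comment> \<open>\<open>g\<close> undoes \<open>c\<close> on words over \<open>V\<close> and
    keeps terminals, so the added rules become identities under it.\<close>
  define g where "g = map (\<lambda>s. case s of Nt k \<Rightarrow> inv_into V f k | Tm a \<Rightarrow> Tm a)"
  define G' where "G' = \<lparr>pterms = pterms G, pnonterms = f ` V,
    prods = (\<lambda>(\<alpha>, \<beta>). (c \<alpha>, c \<beta>)) ` prods G \<union> (\<lambda>a. ([Nt (f (Tm a))], [Tm a])) ` pterms G,
    pstart = f (Nt (pstart G))\<rparr>"
  have G': "pterms G' = pterms G" "pstart G' = f (Nt (pstart G))" 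
    "prods G' = (\<lambda>(\<alpha>, \<beta>). (c \<alpha>, c \<beta>)) ` prods G \<union> (\<lambda>a. ([Nt (f (Tm a))], [Tm a])) ` pterms G"
    "pnonterms G' = f ` V"
    by (simp_all add: G'_def)
  have S: "Nt (pstart G) \<in> V" using wf by (auto simp: V_def alph_def ps_wf_def)
  have TV: "Tm a \<in> V" if "a \<in> pterms G" for a using that by (simp add: V_def alph_def)
  have PV: "set \<alpha> \<subseteq> V" "set \<beta> \<subseteq> V" "\<alpha> \<noteq> []" if "(\<alpha>, \<beta>) \<in> prods G" for \<alpha> \<beta>
    using wf that by (auto simp: ps_wf_def V_def)
  have cV: "set (c x) \<subseteq> alph (pterms G) (f ` V)" if "set x \<subseteq> V" for x
    using that by (auto simp: c_def alph_def)
  have gc: "g (c x) = x" if "set x \<subseteq> V" for x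
    using that f by (induction x) (auto simp: g_def c_def)
  have g_app: "g (x @ y) = g x @ g y" for x y by (simp add: g_def)
  have g_Tm: "g (map Tm w) = map Tm w" for w by (induction w) (auto simp: g_def)
  have wf': "ps_wf G'"
    unfolding ps_wf_def G'
  proof (intro conjI ballI)
    show "finite (pterms G)" using wf by (simp add: ps_wf_def)
    show "finite (f ` V)" using \<open>finite V\<close> by simp
    show "f (Nt (pstart G)) \<in> f ` V" using S by simp
    show "finite ((\<lambda>(\<alpha>, \<beta>). (c \<alpha>, c \<beta>)) ` prods G \<union> (\<lambda>a. ([Nt (f (Tm a))], [Tm a])) ` pterms G)"
      using wf by (simp add: ps_wf_def)
    fix ab assume "ab \<in> (\<lambda>(\<alpha>, \<beta>). (c \<alpha>, c \<beta>)) ` prods G \<union> (\<lambda>a. ([Nt (f (Tm a))], [Tm a])) ` pterms G"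
    then consider \<alpha> \<beta> where "(\<alpha>, \<beta>) \<in> prods G" "ab = (c \<alpha>, c \<beta>)"
      | a where "a \<in> pterms G" "ab = ([Nt (f (Tm a))], [Tm a])" by auto
    then show "case ab of (\<alpha>, \<beta>) \<Rightarrow> set \<alpha> \<subseteq> alph (pterms G) (f ` V) \<and>
      set \<beta> \<subseteq> alph (pterms G) (f ` V) \<and> (\<exists>A. Nt A \<in> set \<alpha>)"
    proof cases
      case 1
      then have "Nt (f (hd \<alpha>)) \<in> set (c \<alpha>)" using PV[of \<alpha> \<beta>] by (auto simp: c_def)
      then show ?thesis using 1 cV PV[of \<alpha> \<beta>] by auto
    next
      case 2
      then show ?thesis using TV by (auto simp: alph_def)
    qed
  qed
  have sound: "(ps_step G)\<^sup>*\<^sup>* (g x) (g y)" if xy: "ps_step G' x y" for x y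
  proof -
    from xy obtain l r u v where l: "(l, r) \<in> prods G'" and x: "x = u @ l @ v" and y: "y = u @ r @ v"
      by (auto simp: ps_step_def)
    from l consider \<alpha> \<beta> where "(\<alpha>, \<beta>) \<in> prods G" "l = c \<alpha>" "r = c \<beta>"
      | a where "a \<in> pterms G" "l = [Nt (f (Tm a))]" "r = [Tm a]" unfolding G' by auto
    then show ?thesis
    proof cases
      case 1
      then have "g l = \<alpha>" "g r = \<beta>" using gc PV by auto
      then have "ps_step G (g x) (g y)" unfolding ps_step_def x y g_app using 1(1) by blast
      then show ?thesis by blast
    next
      case 2
      then have "g l = g r" using TV f by (simp add: g_def)
      then show ?thesis by (simp add: x y g_app)
    qed
  qed
  have sounds: "(ps_step G)\<^sup>*\<^sup>* (g x) (g y)" if "(ps_step G')\<^sup>*\<^sup>* x y" for x y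
    using that by (induction rule: rtranclp_induct) (auto dest: sound)
  have complete: "ps_step G' (c x) (c y)" if "ps_step G x y" for x y
    using that unfolding ps_step_def G' by (fastforce simp: c_def)
  have completes: "(ps_step G')\<^sup>*\<^sup>* (c x) (c y)" if "(ps_step G)\<^sup>*\<^sup>* x y" for x y
    using that by (induction rule: rtranclp_induct) (auto dest: complete intro: rtranclp.rtrancl_into_rtrancl)
  \<comment> \<open>Stand-ins are turned into terminals from left to right; \<open>v\<close> is the
    part already finished.\<close>
  have out: "(ps_step G')\<^sup>*\<^sup>* (map Tm v @ c (map Tm w)) (map Tm (v @ w))" if "set w \<subseteq> pterms G" for v w
    using that
  proof (induction w arbitrary: v)
    case (Cons a w)
    have "ps_step G' (map Tm v @ c (map Tm (a # w))) (map Tm (v @ [a]) @ c (map Tm w))"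
      unfolding ps_step_def G' using Cons.prems
      by (intro bexI[of _ "([Nt (f (Tm a))], [Tm a])"] case_prodI exI[of _ "map Tm v"] exI[of _ "c (map Tm w)"])
         (auto simp: c_def)
    moreover have "(ps_step G')\<^sup>*\<^sup>* (map Tm (v @ [a]) @ c (map Tm w)) (map Tm ((v @ [a]) @ w))"
      by (rule Cons.IH) (use Cons.prems in auto)
    ultimately show ?case by (simp add: converse_rtranclp_into_rtranclp)
  qed (simp add: c_def)
  have "(ps_step G')\<^sup>*\<^sup>* [Nt (f (Nt (pstart G)))] (map Tm w) \<longleftrightarrow> (ps_step G)\<^sup>*\<^sup>* [Nt (pstart G)] (map Tm w)"
    if w: "set w \<subseteq> pterms G" for w
  proof
    assume "(ps_step G')\<^sup>*\<^sup>* [Nt (f (Nt (pstart G)))] (map Tm w)"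
    from sounds[OF this] show "(ps_step G)\<^sup>*\<^sup>* [Nt (pstart G)] (map Tm w)"
      using gc[of "[Nt (pstart G)]"] S by (simp add: g_Tm c_def)
  next
    assume "(ps_step G)\<^sup>*\<^sup>* [Nt (pstart G)] (map Tm w)"
    from completes[OF this] have "(ps_step G')\<^sup>*\<^sup>* [Nt (f (Nt (pstart G)))] (c (map Tm w))"
      by (simp add: c_def)
    also have "(ps_step G')\<^sup>*\<^sup>* (c (map Tm w)) (map Tm w)" using out[OF w, of "[]"] by simp
    finally show "(ps_step G')\<^sup>*\<^sup>* [Nt (f (Nt (pstart G)))] (map Tm w)" .
  qed
  then have "ps_lang G' = ps_lang G" by (auto simp: ps_lang_def G')
  moreover have "\<exists>ks. \<alpha> = map Nt ks" if "(\<alpha>, \<beta>) \<in> prods G'" for \<alpha> \<beta>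
  proof -
    from that consider \<alpha>' where "\<alpha> = c \<alpha>'" | a where "\<alpha> = [Nt (f (Tm a))]" unfolding G' by auto
    then show ?thesis
    proof cases
      case 1
      then have "\<alpha> = map Nt (map f \<alpha>')" by (simp add: c_def)
      then show ?thesis by blast
    next
      case 2
      then have "\<alpha> = map Nt [f (Tm a)]" by simp
      then show ?thesis by blast
    qed
  qed
  ultimately show ?thesis using that wf' by blast
qed

lemma RE_subset_SSCM: "(RE :: 'a list set set) \<subseteq> SSCM_0_star_3"
proof
  fix L :: "'a list set" assume "L \<in> RE"
  then obtain G where "ps_wf G" "L = ps_lang G" by (auto simp: RE_def)
  then show "L \<in> SSCM_0_star_3"
    by (metis nonterminal_lhs_normal_form nonterminal_lhs_in_SSCM)
qed

section \<open>Simulating forbidding matrices by a phrase-structure grammar\<close>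

definition rw_step :: "('b list \<times> 'b list) set \<Rightarrow> 'b list \<Rightarrow> 'b list \<Rightarrow> bool" where
  "rw_step R x y \<longleftrightarrow> (\<exists>(l, r) \<in> R. \<exists>u v. x = u @ l @ v \<and> y = u @ r @ v)"

lemma rw_stepI: "(l, r) \<in> R \<Longrightarrow> x = p @ l @ q \<Longrightarrow> y = p @ r @ q \<Longrightarrow> rw_step R x y"
  unfolding rw_step_def by blast

text \<open>Symbols outside the range of \<open>\<tau>\<close> are numbered and become nonterminals;
  the condition on left-hand sides supplies the nonterminal that a production needs. Heads and
  markers can thus be written as a datatype and need no explicit numbering.\<close>

lemma rewriting_system_in_RE:
  fixes \<tau> :: "'a \<Rightarrow> 'b"
  assumes \<tau>: "inj \<tau>" and T: "finite T" and \<Sigma>: "finite \<Sigma>" "\<Sigma> \<inter> range \<tau> = \<tau> ` T"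
    and R: "finite R" "\<And>l r. (l, r) \<in> R \<Longrightarrow> set l \<subseteq> \<Sigma> \<and> set r \<subseteq> \<Sigma> \<and> \<not> set l \<subseteq> range \<tau>"
    and s: "s \<in> \<Sigma>" "s \<notin> range \<tau>"
  shows "{w. set w \<subseteq> T \<and> (rw_step R)\<^sup>*\<^sup>* [s] (map \<tau> w)} \<in> RE"
proof -
  obtain f :: "'b \<Rightarrow> nat" where f: "inj_on f \<Sigma>"
    using finite_imp_inj_to_nat_seg[OF \<Sigma>(1)] by blast
  define c where "c x = (if x \<in> range \<tau> then Tm (inv \<tau> x) else Nt (f x))" for x
  have c_\<tau>: "c (\<tau> a) = Tm a" for a using \<tau> by (simp add: c_def)
  have inj: "inj_on c \<Sigma>"
  proof (rule inj_onI)
    fix x y assume "x \<in> \<Sigma>" "y \<in> \<Sigma>" "c x = c y"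
    then show "x = y" using f \<tau> by (auto simp: c_def inj_on_def split: if_splits)
  qed
  define G where "G = \<lparr>pterms = T, pnonterms = f ` (\<Sigma> - range \<tau>),
    prods = (\<lambda>(l, r). (map c l, map c r)) ` R, pstart = f s\<rparr>"
  have G: "pterms G = T" "pnonterms G = f ` (\<Sigma> - range \<tau>)"
    "prods G = (\<lambda>(l, r). (map c l, map c r)) ` R" "pstart G = f s" by (simp_all add: G_def)
  have c\<Sigma>: "c x \<in> alph T (f ` (\<Sigma> - range \<tau>))" if "x \<in> \<Sigma>" for x
  proof (cases "x \<in> range \<tau>")
    case True
    then have "x \<in> \<tau> ` T" unfolding \<Sigma>(2)[symmetric] using that by simp
    then obtain a where "x = \<tau> a" "a \<in> T" by blast
    then show ?thesis by (simp add: c_\<tau> alph_def)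
  next
    case False
    then show ?thesis using that by (auto simp: c_def alph_def)
  qed
  have "ps_wf G"
    unfolding ps_wf_def G
  proof (intro conjI ballI)
    fix ab assume "ab \<in> (\<lambda>(l, r). (map c l, map c r)) ` R"
    then obtain l r where lr: "(l, r) \<in> R" "ab = (map c l, map c r)" by auto
    from R(2)[OF lr(1)] obtain x where "x \<in> set l" "x \<notin> range \<tau>" by auto
    then have "Nt (f x) \<in> set (map c l)" by (force simp: c_def)
    then show "case ab of (\<alpha>, \<beta>) \<Rightarrow> set \<alpha> \<subseteq> alph T (f ` (\<Sigma> - range \<tau>)) \<and>
        set \<beta> \<subseteq> alph T (f ` (\<Sigma> - range \<tau>)) \<and> (\<exists>A. Nt A \<in> set \<alpha>)"
      using lr R(2)[OF lr(1)] c\<Sigma> by auto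
  qed (use T \<Sigma> R s in auto)
  have rw_set: "set y \<subseteq> \<Sigma>" if "rw_step R x y" "set x \<subseteq> \<Sigma>" for x y
    using that R(2) unfolding rw_step_def by fastforce
  have fwd: "ps_step G (map c x) (map c y)" if "rw_step R x y" for x y
    using that unfolding rw_step_def ps_step_def G by fastforce
  have bwd: "\<exists>y. z = map c y \<and> rw_step R x y" if z: "ps_step G (map c x) z" and x: "set x \<subseteq> \<Sigma>" for x z
  proof -
    from z obtain l r u v where lr: "(l, r) \<in> R" and eq: "map c x = u @ map c l @ v"
      and z: "z = u @ map c r @ v" unfolding ps_step_def G by auto
    from eq[unfolded map_eq_append_conv] obtain u' m
      where m: "x = u' @ m" "u = map c u'" "map c l @ v = map c m" by blast
    from m(3)[symmetric, unfolded map_eq_append_conv] obtain l' v'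
      where "m = l' @ v'" "map c l = map c l'" "v = map c v'" by blast
    with m have x': "x = u' @ l' @ v'" "u = map c u'" "map c l' = map c l" "v = map c v'" by auto
    \<comment> \<open>\<open>c\<close> is injective only on \<open>\<Sigma>\<close>, so both words
      must lie over it before they can be compared.\<close>
    have "set l' \<union> set l \<subseteq> \<Sigma>" using x x' R(2)[OF lr] by auto
    then have "l' = l" using map_inj_on[OF x'(3)] inj inj_on_subset by blast
    then show ?thesis using lr x' z unfolding rw_step_def
      by (intro exI[of _ "u' @ r @ v'"]) auto
  qed
  have "(rw_step R)\<^sup>*\<^sup>* [s] (map \<tau> w) \<longleftrightarrow> (ps_step G)\<^sup>*\<^sup>* [Nt (f s)] (map Tm w)" if w: "set w \<subseteq> T" for w
  proof
    have "(rw_step R)\<^sup>*\<^sup>* [s] x \<Longrightarrow> (ps_step G)\<^sup>*\<^sup>* [Nt (f s)] (map c x)" for x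
    proof (induction rule: rtranclp_induct)
      case base
      then show ?case using s by (simp add: c_def)
    qed (use fwd in \<open>auto intro: rtranclp.rtrancl_into_rtrancl\<close>)
    moreover have "map c (map \<tau> w) = map Tm w" by (simp add: c_\<tau>)
    moreover assume "(rw_step R)\<^sup>*\<^sup>* [s] (map \<tau> w)"
    ultimately show "(ps_step G)\<^sup>*\<^sup>* [Nt (f s)] (map Tm w)" by metis
  next
    assume *: "(ps_step G)\<^sup>*\<^sup>* [Nt (f s)] (map Tm w)"
    have "(ps_step G)\<^sup>*\<^sup>* [Nt (f s)] z \<Longrightarrow> \<exists>x. z = map c x \<and> set x \<subseteq> \<Sigma> \<and> (rw_step R)\<^sup>*\<^sup>* [s] x" for z
    proof (induction rule: rtranclp_induct)
      case base
      then show ?case using s by (intro exI[of _ "[s]"]) (simp add: c_def)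
    next
      case (step y z)
      then show ?case using bwd rw_set by (metis rtranclp.rtrancl_into_rtrancl)
    qed
    from this[OF *] obtain x where x: "map Tm w = map c x" "set x \<subseteq> \<Sigma>" "(rw_step R)\<^sup>*\<^sup>* [s] x" by blast
    have "map c x = map c (map \<tau> w)" using x(1)[symmetric] by (simp add: c_\<tau>)
    moreover have "set x \<union> set (map \<tau> w) \<subseteq> \<Sigma>" using w x(2) equalityD2[OF \<Sigma>(2)] by auto
    ultimately have "x = map \<tau> w" using map_inj_on[of c x "map \<tau> w"] inj inj_on_subset by blast
    then show "(rw_step R)\<^sup>*\<^sup>* [s] (map \<tau> w)" using x(3) by simp
  qed
  then have "ps_lang G = {w. set w \<subseteq> T \<and> (rw_step R)\<^sup>*\<^sup>* [s] (map \<tau> w)}"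
    by (auto simp: ps_lang_def G)
  then show ?thesis using \<open>ps_wf G\<close> unfolding RE_def by blast
qed

text \<open>\<open>App rs\<close> is the head while the rules \<open>rs\<close> are still to be applied, \<open>Tst r\<close> the head that looks for the
  forbidden word of \<open>r\<close> from left to right, and \<open>Fin\<close> the head that only passes terminals.\<close>

datatype 'a hsym = Sy "'a sym" | LM | RM | S0 | Fin | App "(nat \<times> 'a sym list) list" | Tst "'a matrix"

text \<open>\<open>RM\<close> is not of the form \<open>Sy\<close>, so a window of plain letters
  cannot reach beyond \<open>v\<close>.\<close>

lemma map_Sy_prefix:
  assumes "map Sy z @ q = map Sy v @ [RM]"
  obtains v' where "v = z @ v'" "q = map Sy v' @ [RM]"
  using assms
proof (induction z arbitrary: v thesis)
  case (Cons s z)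
  obtain v1 where v: "v = s # v1" "map Sy z @ q = map Sy v1 @ [RM]"
    using Cons.prems(2) by (cases v) auto
  show ?case by (rule Cons.IH[OF _ v(2)]) (use Cons.prems(1) v(1) in auto)
qed auto

section \<open>The rewriting system with a walking head\<close>

locale forbidding_scm =
  fixes G :: "'a scm_grammar"
  assumes wf: "scm_wf G" and no_permit: "r \<in> smats G \<Longrightarrow> permit r = None"
begin

abbreviation V :: "'a sym set" where "V \<equiv> alph (sterms G) (snonterms G)"

text \<open>The states of the head while a matrix is applied, namely what is left of its rule list.
  The empty list is the idle state and is present even if there are no matrices.\<close>

definition Suf :: "(nat \<times> 'a sym list) list set" where
  "Suf = insert [] (\<Union>r \<in> smats G. set (suffixes (rules r)))"

text \<open>Requiring \<open>LM\<close> next to the idle head makes a test begin at the left end.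
  \<open>scan\<close> compares a window of the length of \<open>F\<close> and moves by one letter;
  \<open>pass\<close> applies once \<open>RM\<close> shows that less than such a window remains.
  \<open>App\<close> heads walk in both directions, so every occurrence can be rewritten.\<close>

inductive_set R :: "('a hsym list \<times> 'a hsym list) set" where
  start: "([S0], [LM, App [], Sy (Nt (sstart G)), RM]) \<in> R"
| stop: "([LM, App []], [Fin]) \<in> R"
| erase: "([Fin, RM], []) \<in> R"
| emit: "a \<in> sterms G \<Longrightarrow> ([Fin, Sy (Tm a)], [Sy (Tm a), Fin]) \<in> R"
| right: "rs \<in> Suf \<Longrightarrow> x \<in> V \<Longrightarrow> ([App rs, Sy x], [Sy x, App rs]) \<in> R"
| left: "rs \<in> Suf \<Longrightarrow> x \<in> V \<Longrightarrow> ([Sy x, App rs], [App rs, Sy x]) \<in> R"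
| replace: "(A, w) # rs \<in> Suf \<Longrightarrow> ([App ((A, w) # rs), Sy (Nt A)], App rs # map Sy w) \<in> R"
| test: "r \<in> smats G \<Longrightarrow> ([LM, App []], [LM, Tst r]) \<in> R"
| free: "r \<in> smats G \<Longrightarrow> forbid r = None \<Longrightarrow> ([Tst r], [App (rules r)]) \<in> R"
| scan: "r \<in> smats G \<Longrightarrow> forbid r = Some F \<Longrightarrow> set (a # z) \<subseteq> V \<Longrightarrow> length (a # z) = length F \<Longrightarrow>
    a # z \<noteq> F \<Longrightarrow> (Tst r # map Sy (a # z), Sy a # Tst r # map Sy z) \<in> R"
| pass: "r \<in> smats G \<Longrightarrow> forbid r = Some F \<Longrightarrow> set z \<subseteq> V \<Longrightarrow> length z < length F \<Longrightarrow>
    (Tst r # map Sy z @ [RM], App (rules r) # map Sy z @ [RM]) \<in> R"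

lemma finite_V: "finite V"
  using wf by (simp add: scm_wf_def alph_def)

definition \<Sigma> :: "'a hsym set" where
  "\<Sigma> = Sy ` V \<union> {S0, LM, RM, Fin} \<union> App ` Suf \<union> Tst ` smats G"

lemma finite_\<Sigma>: "finite \<Sigma>"
  using wf finite_V by (auto simp: \<Sigma>_def scm_wf_def Suf_def)

lemma Suf_Cons:
  assumes "(A, w) # rs \<in> Suf"
  obtains r where "r \<in> smats G" "(A, w) \<in> set (rules r)" "A \<in> snonterms G" "set w \<subseteq> V" "rs \<in> Suf"
proof -
  from assms obtain r where r: "r \<in> smats G" "suffix ((A, w) # rs) (rules r)" by (auto simp: Suf_def)
  then have "(A, w) \<in> set (rules r)" by (auto simp: suffix_def)
  moreover have "rs \<in> Suf" using r suffix_ConsD[OF r(2)] by (auto simp: Suf_def)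
  ultimately show ?thesis using r(1) wf that[of r] unfolding scm_wf_def by fastforce
qed

lemma R_alphabet:
  assumes "(l, r) \<in> R"
  shows "set l \<subseteq> \<Sigma> \<and> set r \<subseteq> \<Sigma> \<and> \<not> set l \<subseteq> range (\<lambda>a. Sy (Tm a))"
proof -
  have nil: "[] \<in> Suf" by (simp add: Suf_def)
  have rs: "rules r \<in> Suf" if "r \<in> smats G" for r using that by (auto simp: Suf_def)
  have st: "Nt (sstart G) \<in> V" using wf by (auto simp: scm_wf_def alph_def)
  from assms show ?thesis
  proof (cases rule: R.cases)
    case (replace A w rs)
    from replace(3) obtain r' where "A \<in> snonterms G" "set w \<subseteq> V" "rs \<in> Suf" by (rule Suf_Cons)
    then show ?thesis using replace by (auto simp: \<Sigma>_def alph_def)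
  qed (use nil st rs in \<open>auto simp: \<Sigma>_def alph_def\<close>)
qed

text \<open>Both sides of every rule are words of bounded length over a finite alphabet.\<close>

lemma finite_R: "finite R"
proof -
  have M: "finite (smats G)" using wf by (auto simp: scm_wf_def)
  let ?X = "(\<Union>r \<in> smats G. (\<lambda>p. length (snd p)) ` set (rules r)) \<union>
      (\<lambda>r. length (the (forbid r))) ` smats G"
  define B where "B = Max ?X"
  have "finite ?X" using M by simp
  then have max: "n \<le> B" if "n \<in> ?X" for n unfolding B_def using that by (rule Max_ge)
  have B1: "length w \<le> B" if "r \<in> smats G" "(A, w) \<in> set (rules r)" for r A w
    using that by (intro max UnI1 UN_I[of r] image_eqI[of _ _ "(A, w)"]) auto
  have B2: "length F \<le> B" if "r \<in> smats G" "forbid r = Some F" for r F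
    using that by (intro max UnI2 image_eqI[of _ _ r]) auto
  \<comment> \<open>The summand 4 is the length of the right-hand side of \<open>start\<close>; it
    also covers the head and the markers in the other rules.\<close>
  have "length l \<le> B + 4 \<and> length r \<le> B + 4" if "(l, r) \<in> R" for l r
    using that
  proof (cases rule: R.cases)
    case (replace A w rs)
    from replace(3) obtain r' where "r' \<in> smats G" "(A, w) \<in> set (rules r')" by (rule Suf_Cons)
    from B1[OF this] show ?thesis using replace by simp
  next
    case (scan r' F a z)
    then show ?thesis using B2[OF scan(3,4)] by simp
  next
    case (pass r' F z)
    then show ?thesis using B2[OF pass(3,4)] by simp
  qed simp_all
  then have "R \<subseteq> {l. set l \<subseteq> \<Sigma> \<and> length l \<le> B + 4} \<times> {l. set l \<subseteq> \<Sigma> \<and> length l \<le> B + 4}"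
    by (auto dest: R_alphabet[THEN conjunct1, THEN subsetD] R_alphabet[THEN conjunct2, THEN conjunct1, THEN subsetD])
  then show ?thesis
    using finite_lists_length_le[OF finite_\<Sigma>, of "B + 4"] by (meson finite_SigmaI finite_subset)
qed

section \<open>The soundness invariant of the head system\<close>

abbreviation reach :: "'a sym list \<Rightarrow> bool" where
  "reach \<equiv> (scm_step G)\<^sup>*\<^sup>* [Nt (sstart G)]"

text \<open>\<open>LM\<close> is consumed when \<open>stop\<close> creates \<open>Fin\<close>,
  whereas \<open>RM\<close> survives until \<open>erase\<close>.\<close>

fun lmark rmark :: "'a hsym \<Rightarrow> 'a hsym list" where
  "lmark (App rs) = [LM]"
| "lmark (Tst r) = [LM]"
| "lmark _ = []"
| "rmark (App rs) = [RM]"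
| "rmark (Tst r) = [RM]"
| "rmark Fin = [RM]"
| "rmark _ = []"

text \<open>For \<open>App rs\<close> all outcomes of the remaining rules must be reachable, so the
  free choice of an occurrence by \<open>replace\<close> keeps the invariant. For
  \<open>Tst r\<close> no occurrence of the forbidden word starts to the left of the head.\<close>

fun good :: "'a hsym \<Rightarrow> 'a sym list \<Rightarrow> 'a sym list \<Rightarrow> bool" where
  "good S0 u v \<longleftrightarrow> u = [] \<and> v = []"
| "good (App rs) u v \<longleftrightarrow> (\<forall>y. apply_rules rs (u @ v) y \<longrightarrow> reach y)"
| "good (Tst r) u v \<longleftrightarrow> r \<in> smats G \<and> reach (u @ v) \<and>
     (\<forall>F s t. forbid r = Some F \<longrightarrow> u @ v = s @ F @ t \<longrightarrow> length u \<le> length s)"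
| "good Fin u v \<longleftrightarrow> reach (u @ v)"
| "good _ u v \<longleftrightarrow> False"

definition inv_word :: "'a hsym list \<Rightarrow> bool" where
  "inv_word z \<longleftrightarrow> (\<exists>u. z = map Sy u \<and> reach u) \<or>
     (\<exists>H u v. z = lmark H @ map Sy u @ H # map Sy v @ rmark H \<and> good H u v)"

lemma inv_wordI: "good H u v \<Longrightarrow> z = lmark H @ map Sy u @ H # map Sy v @ rmark H \<Longrightarrow> inv_word z"
  unfolding inv_word_def by blast

text \<open>A good configuration has exactly one head, so a head found in it must be this one, and
  the contexts on both sides agree.\<close>

lemma head_unique:
  assumes "good H u v" "lmark H @ map Sy u @ H # map Sy v @ rmark H = p @ l1 @ h # l2 @ q"
    "h \<in> {S0, Fin} \<union> range App \<union> range Tst"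
  shows "h = H \<and> p @ l1 = lmark H @ map Sy u \<and> l2 @ q = map Sy v @ rmark H"
proof -
  have H: "H \<notin> set (lmark H @ map Sy u)" "H \<notin> set (map Sy v @ rmark H)"
    using assms(1) by (cases H; auto)+
  have "h \<in> set (lmark H @ map Sy u @ H # map Sy v @ rmark H)" unfolding assms(2) by simp
  then have "h = H" using assms(3) by (cases H) auto
  then show ?thesis using append_Cons_eq_iff[OF H, of "p @ l1" "l2 @ q"] assms(2) by simp
qed

lemma inv_word_step:
  assumes "inv_word x" "rw_step R x y"
  shows "inv_word y"
proof -
  from assms(2) obtain l r p q where lr: "(l, r) \<in> R" and x: "x = p @ l @ q" and y: "y = p @ r @ q"
    by (auto simp: rw_step_def)
  from lr obtain l1 h l2 where l: "l = l1 @ h # l2" and h: "h \<in> {S0, Fin} \<union> range App \<union> range Tst"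
  proof (cases rule: R.cases)
    case stop
    then show ?thesis using that[of "[LM]" "App []" "[]"] by simp
  next
    case (left rs x)
    then show ?thesis using that[of "[Sy x]" "App rs" "[]"] by simp
  next
    case (test r)
    then show ?thesis using that[of "[LM]" "App []" "[]"] by simp
  qed (use that[of "[]"] in auto)
  \<comment> \<open>Words without a head have no successor, as each left-hand side contains a
    head.\<close>
  have "\<not> (\<exists>u. x = map Sy u)"
  proof
    assume "\<exists>u. x = map Sy u"
    then have "set x \<subseteq> range Sy" by auto
    moreover have "h \<in> set x" by (simp add: x l)
    ultimately show False using h by auto
  qed
  then obtain H u v where z: "x = lmark H @ map Sy u @ H # map Sy v @ rmark H" and g: "good H u v"
    using assms(1) by (auto simp: inv_word_def)
  have m: "h = H" "p @ l1 = lmark H @ map Sy u" "l2 @ q = map Sy v @ rmark H"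
    if "l = l1 @ h # l2" "h \<in> {S0, Fin} \<union> range App \<union> range Tst" for l1 h l2
    using head_unique[OF g, of p l1 h l2 q] z x that by auto
  from lr show ?thesis
  proof (cases rule: R.cases)
    case start
    have "H = S0" using m(1)[of "[]" S0 "[]"] start by simp
    then have "y = lmark (App []) @ map Sy [] @ App [] # map Sy [Nt (sstart G)] @ rmark (App [])"
      using g z x y start by (auto simp: Cons_eq_append_conv append_eq_Cons_conv)
    then show ?thesis by (rule inv_wordI[rotated]) simp
  next
    case stop
    have H: "H = App []" using m(1)[of "[LM]" "App []" "[]"] stop by auto
    then have "p @ [LM] = [LM] @ map Sy u" "q = map Sy v @ [RM]"
      using m(2,3)[of "[LM]" "App []" "[]"] stop by auto
    then have "u = []" "p = []" by (cases u rule: rev_cases; auto)+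
    then show ?thesis using g H y stop \<open>q = _\<close> by (intro inv_wordI[of Fin "[]" v]) auto
  next
    case erase
    have H: "H = Fin" using m(1)[of "[]" Fin "[RM]"] erase by auto
    then have "p = map Sy u" "RM # q = map Sy v @ [RM]"
      using m(2,3)[of "[]" Fin "[RM]"] erase by auto
    then have "v = []" "q = []" by (cases v; auto)+
    then show ?thesis using g H y erase \<open>p = _\<close> unfolding inv_word_def by auto
  next
    case (right rs a)
    have H: "H = App rs" using m(1)[of "[]" "App rs" "[Sy a]"] right by auto
    then have p: "p = LM # map Sy u" and "map Sy [a] @ q = map Sy v @ [RM]"
      using m(2,3)[of "[]" "App rs" "[Sy a]"] right by auto
    then obtain v' where "v = a # v'" "q = map Sy v' @ [RM]" by (elim map_Sy_prefix) auto
    then show ?thesis using g H y right p by (intro inv_wordI[of "App rs" "u @ [a]" v']) auto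
  next
    case (left rs a)
    have H: "H = App rs" using m(1)[of "[Sy a]" "App rs" "[]"] left by auto
    then have "p @ [Sy a] = LM # map Sy u" and q: "q = map Sy v @ [RM]"
      using m(2,3)[of "[Sy a]" "App rs" "[]"] left by auto
    then obtain u' where "u = u' @ [a]" "p = LM # map Sy u'" by (cases u rule: rev_cases) auto
    then show ?thesis using g H y left q by (intro inv_wordI[of "App rs" u' "a # v"]) auto
  next
    case (replace A w rs)
    have H: "H = App ((A, w) # rs)" using m(1)[of "[]" "App ((A, w) # rs)" "[Sy (Nt A)]"] replace by auto
    then have p: "p = LM # map Sy u" and "map Sy [Nt A] @ q = map Sy v @ [RM]"
      using m(2,3)[of "[]" "App ((A, w) # rs)" "[Sy (Nt A)]"] replace by auto
    then obtain v' where "v = Nt A # v'" "q = map Sy v' @ [RM]" by (elim map_Sy_prefix) auto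
    then show ?thesis using g H y replace p by (intro inv_wordI[of "App rs" u "w @ v'"]) auto
  next
    case (test r)
    have H: "H = App []" using m(1)[of "[LM]" "App []" "[]"] test by auto
    then have "p @ [LM] = [LM] @ map Sy u" "q = map Sy v @ [RM]"
      using m(2,3)[of "[LM]" "App []" "[]"] test by auto
    then have "u = []" "p = []" by (cases u rule: rev_cases; auto)+
    then show ?thesis using g H y test \<open>q = _\<close> by (intro inv_wordI[of "Tst r" "[]" v]) auto
  next
    case (free r)
    have H: "H = Tst r" using m(1)[of "[]" "Tst r" "[]"] free by auto
    then have p: "p = LM # map Sy u" "q = map Sy v @ [RM]"
      using m(2,3)[of "[]" "Tst r" "[]"] free by auto
    have "reach y'" if "apply_rules (rules r) (u @ v) y'" for y'
    proof -
      have "scm_step G (u @ v) y'" unfolding scm_step_def mat_step_def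
        using free no_permit[of r] that by (intro bexI[of _ r]) auto
      then show ?thesis using g H by (auto intro: rtranclp.rtrancl_into_rtrancl)
    qed
    then show ?thesis using y free p by (intro inv_wordI[of "App (rules r)" u v]) auto
  next
    case (scan r F a z)
    have H: "H = Tst r" using m(1)[of "[]" "Tst r" "map Sy (a # z)"] scan by auto
    then have p: "p = LM # map Sy u" and "map Sy (a # z) @ q = map Sy v @ [RM]"
      using m(2,3)[of "[]" "Tst r" "map Sy (a # z)"] scan by auto
    then obtain v' where v': "v = (a # z) @ v'" "q = map Sy v' @ [RM]" by (elim map_Sy_prefix) auto
    \<comment> \<open>An occurrence of \<open>F\<close> starting exactly at the head would be the
      window \<open>a # z\<close>, which has the same length but differs from
      \<open>F\<close>.\<close>
    have "Suc (length u) \<le> length s" if st: "u @ v = s @ F @ t" for s t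
    proof (rule ccontr)
      assume "\<not> Suc (length u) \<le> length s"
      moreover have "length u \<le> length s" using g H st scan by auto
      ultimately have "s = u" "F @ t = v" using st by auto
      then show False using v' scan(6,7) by (metis append_eq_append_conv)
    qed
    then have "good (Tst r) (u @ [a]) (z @ v')" using g H v' scan by auto
    then show ?thesis using y scan p v' by (intro inv_wordI[of "Tst r" "u @ [a]" "z @ v'"]) auto
  next
    case (pass r F z)
    have H: "H = Tst r" using m(1)[of "[]" "Tst r" "map Sy z @ [RM]"] pass by auto
    then have p: "p = LM # map Sy u" and "map Sy z @ (RM # q) = map Sy v @ [RM]"
      using m(2,3)[of "[]" "Tst r" "map Sy z @ [RM]"] pass by auto
    then obtain v' where v': "v = z @ v'" "RM # q = map Sy v' @ [RM]" by (elim map_Sy_prefix)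
    then have v: "v = z" "q = []" by (cases v'; auto)+
    \<comment> \<open>An occurrence would start at the head or later, but fewer letters than the
      length of \<open>F\<close> are left there.\<close>
    have "\<not> sublist F (u @ v)"
    proof
      assume "sublist F (u @ v)"
      then obtain s t where st: "u @ v = s @ F @ t" by (auto simp: sublist_def)
      then have "length u \<le> length s" using g H pass by auto
      moreover have "length (u @ v) = length (s @ F @ t)" using st by simp
      ultimately show False using pass(6) v by simp
    qed
    then have "reach y'" if "apply_rules (rules r) (u @ v) y'" for y'
    proof -
      have "scm_step G (u @ v) y'" unfolding scm_step_def mat_step_def 
        using pass(3,4) no_permit[of r] that \<open>\<not> sublist F (u @ v)\<close> by (intro bexI[of _ r]) auto
      then show ?thesis using g H by (auto intro: rtranclp.rtrancl_into_rtrancl)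
    qed
    then show ?thesis using y pass p v by (intro inv_wordI[of "App (rules r)" u v]) auto
  next
    case (emit a)
    have H: "H = Fin" using m(1)[of "[]" "Fin" "[Sy (Tm a)]"] emit by auto
    then have p: "p = map Sy u" and "map Sy [Tm a] @ q = map Sy v @ [RM]"
      using m(2,3)[of "[]" "Fin" "[Sy (Tm a)]"] emit by auto
    then obtain v' where "v = Tm a # v'" "q = map Sy v' @ [RM]" by (elim map_Sy_prefix) auto
    then show ?thesis using g H y emit p by (intro inv_wordI[of Fin "u @ [Tm a]" v']) auto
  qed
qed

section \<open>Simulation of matrix derivations by the head system\<close>

abbreviation conf :: "'a hsym \<Rightarrow> 'a sym list \<Rightarrow> 'a sym list \<Rightarrow> 'a hsym list" where
  "conf H u v \<equiv> LM # map Sy u @ H # map Sy v @ [RM]"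

abbreviation rws :: "'a hsym list \<Rightarrow> 'a hsym list \<Rightarrow> bool" where
  "rws \<equiv> (rw_step R)\<^sup>*\<^sup>*"

lemma move_right:
  assumes "rs \<in> Suf" "set v \<subseteq> V"
  shows "rws (conf (App rs) u (v @ w)) (conf (App rs) (u @ v) w)"
  using assms(2)
proof (induction v arbitrary: u)
  case (Cons a v)
  have "rw_step R (conf (App rs) u ((a # v) @ w)) (conf (App rs) (u @ [a]) (v @ w))"
    using assms(1) Cons.prems
    by (intro rw_stepI[OF R.right[of rs a], of _ "LM # map Sy u" "map Sy (v @ w) @ [RM]"]) auto
  then show ?case using Cons.IH[of "u @ [a]"] Cons.prems by (auto intro: converse_rtranclp_into_rtranclp)
qed auto

lemma move_left:
  assumes "rs \<in> Suf" "set u \<subseteq> V"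
  shows "rws (conf (App rs) u v) (conf (App rs) [] (u @ v))"
  using assms(2)
proof (induction u arbitrary: v rule: rev_induct)
  case (snoc a u)
  have "rw_step R (conf (App rs) (u @ [a]) v) (conf (App rs) u (a # v))"
    using assms(1) snoc.prems
    by (intro rw_stepI[OF R.left[of rs a], of _ "LM # map Sy u" "map Sy v @ [RM]"]) auto
  then show ?case using snoc.IH[of "a # v"] snoc.prems by (auto intro: converse_rtranclp_into_rtranclp)
qed auto

text \<open>The head is carried to the chosen occurrence, rewrites it and returns to the left
  marker, ready for the next rule.\<close>

lemma simulate_rules:
  assumes "apply_rules rs x y" "rs \<in> Suf" "set x \<subseteq> V"
  shows "rws (conf (App rs) [] x) (conf (App []) [] y) \<and> set y \<subseteq> V"
  using assms
proof (induction rs arbitrary: x)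
  case (Cons r rs)
  obtain A w where r: "r = (A, w)" by force
  with Cons.prems obtain u v where x: "x = u @ [Nt A] @ v" and a: "apply_rules rs (u @ w @ v) y" by auto
  have S: "set w \<subseteq> V" "rs \<in> Suf" using Cons.prems(2) unfolding r by (auto elim: Suf_Cons)
  have s: "set u \<subseteq> V" "set v \<subseteq> V" using Cons.prems x by auto
  have "rws (conf (App (r # rs)) [] x) (conf (App (r # rs)) u (Nt A # v))"
    using move_right[OF Cons.prems(2) s(1), of "[]" "Nt A # v"] x by simp
  also have "rw_step R (conf (App (r # rs)) u (Nt A # v)) (conf (App rs) u (w @ v))"
    using Cons.prems(2) r
    by (intro rw_stepI[OF R.replace[of A w rs], of _ "LM # map Sy u" "map Sy v @ [RM]"]) auto
  also have "rws (conf (App rs) u (w @ v)) (conf (App rs) [] (u @ w @ v))"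
    using move_left S s by blast
  also have "rws (conf (App rs) [] (u @ w @ v)) (conf (App []) [] y)"
    using Cons.IH[OF a S(2)] S s by simp
  finally show ?case using Cons.IH[OF a S(2)] S s by simp
qed auto

text \<open>As \<open>F\<close> does not occur, \<open>scan\<close> applies while a full window is
  left to the right of the head, and \<open>pass\<close> afterwards.\<close>

lemma simulate_test:
  assumes r: "r \<in> smats G" "forbid r = Some F" and s: "set (u @ v) \<subseteq> V" and F: "\<not> sublist F (u @ v)"
  shows "\<exists>u' v'. u' @ v' = u @ v \<and> rws (conf (Tst r) u v) (conf (App (rules r)) u' v')"
  using s F
proof (induction v arbitrary: u)
  case (Cons a v)
  have F0: "F \<noteq> []" using Cons.prems by auto
  show ?case
  proof (cases "length (a # v) < length F")
    case True
    then have "rw_step R (conf (Tst r) u (a # v)) (conf (App (rules r)) u (a # v))"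
      using r Cons.prems
      by (intro rw_stepI[OF R.pass[OF r, of "a # v"], of _ "LM # map Sy u" "[]"]) auto
    then show ?thesis by blast
  next
    case False
    \<comment> \<open>The letter \<open>a\<close> is the first of the window, so
      \<open>length F - 1\<close> letters of \<open>v\<close> complete it.\<close>
    define z where "z = take (length F - 1) v"
    define w where "w = drop (length F - 1) v"
    have zw: "v = z @ w" by (simp add: z_def w_def)
    have l: "length (a # z) = length F" using False F0 by (cases F) (auto simp: z_def)
    have "a # z \<noteq> F" using Cons.prems(2) zw by (metis append_Cons sublist_appendI)
    then have "rw_step R (conf (Tst r) u (a # v)) (conf (Tst r) (u @ [a]) v)"
      using r Cons.prems(1) l zw
      by (intro rw_stepI[OF R.scan[OF r, of a z], of _ "LM # map Sy u" "map Sy w @ [RM]"]) auto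
    moreover obtain u' v' where "u' @ v' = u @ a # v" "rws (conf (Tst r) (u @ [a]) v) (conf (App (rules r)) u' v')"
      using Cons.IH[of "u @ [a]"] Cons.prems by auto
    ultimately show ?thesis
      by (intro exI[of _ u'] exI[of _ v'] conjI) (auto intro: converse_rtranclp_into_rtranclp)
  qed
next
  case Nil
  then have "F \<noteq> []" by auto
  then have "rw_step R (conf (Tst r) u []) (conf (App (rules r)) u [])"
    by (intro rw_stepI[OF R.pass[OF r, of "[]"], of _ "LM # map Sy u" "[]"]) auto
  then show ?case by blast
qed

lemma simulate_step:
  assumes "scm_step G x y" "set x \<subseteq> V"
  shows "rws (conf (App []) [] x) (conf (App []) [] y) \<and> set y \<subseteq> V"
proof -
  from assms(1) obtain r where r: "r \<in> smats G" "mat_step r x y" by (auto simp: scm_step_def)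
  have S: "rules r \<in> Suf" using r by (auto simp: Suf_def)
  have a: "apply_rules (rules r) x y" using r by (auto simp: mat_step_def)
  have 1: "rw_step R (conf (App []) [] x) (conf (Tst r) [] x)"
    using r by (intro rw_stepI[OF R.test[of r], of _ "[]" "map Sy x @ [RM]"]) auto
  have "\<exists>u' v'. u' @ v' = x \<and> rws (conf (Tst r) [] x) (conf (App (rules r)) u' v')"
  proof (cases "forbid r")
    case None
    then have "rw_step R (conf (Tst r) [] x) (conf (App (rules r)) [] x)"
      using r by (intro rw_stepI[OF R.free[of r], of _ "[LM]" "map Sy x @ [RM]"]) auto
    then show ?thesis by (intro exI[of _ "[]"] exI[of _ x]) auto
  next
    case (Some F)
    then show ?thesis using simulate_test[OF r(1) Some, of "[]" x] assms(2) r(2) by (auto simp: mat_step_def)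
  qed
  then obtain u' v' where uv: "u' @ v' = x" "rws (conf (Tst r) [] x) (conf (App (rules r)) u' v')" by blast
  \<comment> \<open>The test may leave the head inside the word or at its right end; it is brought
    back before the rules are applied.\<close>
  moreover have "rws (conf (App (rules r)) u' v') (conf (App (rules r)) [] x)"
    using move_left[OF S, of u' v'] uv(1) assms(2) by auto
  ultimately show ?thesis using simulate_rules[OF a S assms(2)] 1
    by (meson converse_rtranclp_into_rtranclp rtranclp_trans)
qed

lemma simulate_reach:
  assumes "reach x"
  shows "rws [S0] (conf (App []) [] x) \<and> set x \<subseteq> V"
  using assms
proof (induction rule: rtranclp_induct)
  case base
  have "rw_step R [S0] (conf (App []) [] [Nt (sstart G)])"
    by (rule rw_stepI[OF R.start, of _ "[]" "[]"]) auto
  then show ?case using wf by (auto simp: scm_wf_def alph_def)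
next
  case (step x y)
  then show ?case using simulate_step[of x y] by (meson rtranclp_trans)
qed

lemma finish:
  assumes "set w \<subseteq> sterms G"
  shows "rws (map Sy u @ Fin # map Sy (map Tm w) @ [RM]) (map Sy (u @ map Tm w))"
  using assms
proof (induction w arbitrary: u)
  case Nil
  have "rw_step R (map Sy u @ Fin # map Sy (map Tm []) @ [RM]) (map Sy u)"
    by (rule rw_stepI[OF R.erase, of _ "map Sy u" "[]"]) auto
  then show ?case by auto
next
  case (Cons a w)
  have "rw_step R (map Sy u @ Fin # map Sy (map Tm (a # w)) @ [RM]) (map Sy (u @ [Tm a]) @ Fin # map Sy (map Tm w) @ [RM])"
    using Cons.prems
    by (intro rw_stepI[OF R.emit[of a], of _ "map Sy u" "map Sy (map Tm w) @ [RM]"]) auto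
  then show ?case using Cons.IH[of "u @ [Tm a]"] Cons.prems by (auto intro: converse_rtranclp_into_rtranclp)
qed

lemma scm_lang_eq_rewriting:
  "scm_lang G = {w. set w \<subseteq> sterms G \<and> rws [S0] (map (\<lambda>a. Sy (Tm a)) w)}"
proof -
  have "reach (map Tm w) \<longleftrightarrow> rws [S0] (map (\<lambda>a. Sy (Tm a)) w)" if w: "set w \<subseteq> sterms G" for w
  proof
    assume "reach (map Tm w)"
    then have "rws [S0] (conf (App []) [] (map Tm w))" using simulate_reach by blast
    also have "rw_step R (conf (App []) [] (map Tm w)) (map Sy [] @ Fin # map Sy (map Tm w) @ [RM])"
      by (rule rw_stepI[OF R.stop, of _ "[]" "map Sy (map Tm w) @ [RM]"]) auto
    also have "rws \<dots> (map Sy ([] @ map Tm w))" by (rule finish[OF w])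
    finally show "rws [S0] (map (\<lambda>a. Sy (Tm a)) w)" by (simp add: o_def)
  next
    assume *: "rws [S0] (map (\<lambda>a. Sy (Tm a)) w)"
    have "inv_word z" if "rws [S0] z" for z
      using that
    proof (induction rule: rtranclp_induct)
      case base
      show ?case by (rule inv_wordI[of S0 "[]" "[]"]) auto
    qed (rule inv_word_step)
    from this[OF *] have "inv_word (map (\<lambda>a. Sy (Tm a)) w)" .
    \<comment> \<open>A word of terminals contains no head, so only the headless case of the
      invariant remains.\<close>
    moreover have False if "map (\<lambda>a. Sy (Tm a)) w = lmark H @ map Sy u @ H # map Sy v @ rmark H" "good H u v" for H u v
    proof -
      have "H \<in> set (map (\<lambda>a. Sy (Tm a)) w)" unfolding that(1) by simp
      then show False using that(2) by auto
    qed
    ultimately obtain u where u: "map (\<lambda>a. Sy (Tm a)) w = map Sy u" "reach u"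
      unfolding inv_word_def by blast
    have "map Sy (map Tm w) = map Sy u" using u(1) by (simp add: o_def)
    then have "u = map Tm w" by (metis hsym.inject(1) injI inj_map_eq_map)
    then show "reach (map Tm w)" using u(2) by simp
  qed
  then show ?thesis by (auto simp: scm_lang_def)
qed

lemma scm_lang_in_RE: "scm_lang G \<in> RE"
  unfolding scm_lang_eq_rewriting
proof (rule rewriting_system_in_RE)
  show "inj (\<lambda>a. Sy (Tm a))" by (auto intro: injI)
  show "finite (sterms G)" using wf by (simp add: scm_wf_def)
  show "\<Sigma> \<inter> range (\<lambda>a. Sy (Tm a)) = (\<lambda>a. Sy (Tm a)) ` sterms G" by (auto simp: \<Sigma>_def alph_def)
  show "S0 \<in> \<Sigma>" "S0 \<notin> range (\<lambda>a. Sy (Tm a))" by (auto simp: \<Sigma>_def)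
qed (use finite_\<Sigma> finite_R R_alphabet in auto)

end

lemma SSCM_subset_RE: "(SSCM_0_star_3 :: 'a list set set) \<subseteq> RE"
proof
  fix L :: "'a list set" assume "L \<in> SSCM_0_star_3"
  then obtain G where G: "scm_wf G" "\<forall>r \<in> smats G. permit r = None" "L = scm_lang G"
    by (auto simp: SSCM_0_star_3_def)
  then interpret forbidding_scm G by unfold_locales auto
  show "L \<in> RE" using scm_lang_in_RE G(3) by simp
qed

theorem mainTheorem10:
  shows "(SSCM_0_star_3 :: 'a list set set) = RE"
  using SSCM_subset_RE RE_subset_SSCM by blast

end
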